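(* There is an absolute constant $C>0$ such that the following holds. Let $R\ge2$ be an integer, let $R_*$ be the odd and $R_{**}$ the even element of $\{R,R+1\}$, and let $\alpha$ be an irrational number whose regular continued fraction expansion is (eventually) periodic with period block $R_{**},R_*,R_*,R_*,R_*$. Then $$\left|\rho(\alpha)-\frac14\left(1-\frac{2}{R_*}-\frac{2}{R_*^2}\right)\right|\le\frac{C}{R_*^3}.$$
   Context: For real $x$, $\|x\|$ is the distance to the nearest integer. $M(\alpha,\gamma):=\liminf_{|n|\to\infty}|n|\,\|n\alpha-\gamma\|$ ($n\in\mathbb Z$), and $\rho(\alpha):=\sup\{M(\alpha,\gamma):\gamma\in\mathbb R\setminus(\mathbb Z+\alpha\mathbb Z)\}$. The regular continued fraction expansion is $\alpha=[a_0;a_1,a_2,\dots]=a_0+\cfrac1{a_1+\cfrac1{a_2+\cdots}}$ with $a_0=\lfloor\alpha\rfloor$, $a_i\ge1$. *)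

theory Defs
  imports "HOL-Analysis.Analysis"
begin

definition dist_int :: "real \<Rightarrow> real" where
  "dist_int x = infdist x \<int>"

(* The filter is |n| -> infinity over all integers n, positive and negative.  Both quantities below
   are formed in the extended reals, so that the lower limit and the supremum always exist. *)
definition approx_const :: "real \<Rightarrow> real \<Rightarrow> ereal" where
  "approx_const \<alpha> \<gamma> =
     Liminf (filtercomap (\<lambda>n::int. \<bar>n\<bar>) at_top)
       (\<lambda>n. ereal (\<bar>real_of_int n\<bar> * dist_int (real_of_int n * \<alpha> - \<gamma>)))"

definition rho :: "real \<Rightarrow> ereal" where
  "rho \<alpha> = (SUP \<gamma> \<in> - {real_of_int m + real_of_int k * \<alpha> | m k. True}. approx_const \<alpha> \<gamma>)"

(* cf_convergent a n = [a 0; a 1, ..., a n] *)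
fun cf_convergent :: "(nat \<Rightarrow> int) \<Rightarrow> nat \<Rightarrow> real" where
  "cf_convergent a 0 = real_of_int (a 0)"
| "cf_convergent a (Suc n) = real_of_int (a 0) + 1 / cf_convergent (\<lambda>i. a (Suc i)) n"

(* Only infinite expansions, i.e. those of irrational numbers, are covered. *)
definition regular_cf :: "real \<Rightarrow> (nat \<Rightarrow> int) \<Rightarrow> bool" where
  "regular_cf \<alpha> a \<longleftrightarrow>
     a 0 = \<lfloor>\<alpha>\<rfloor> \<and> (\<forall>i\<ge>1. a i \<ge> 1) \<and> cf_convergent a \<longlonglongrightarrow> \<alpha>"

definition eventually_periodic :: "'a list \<Rightarrow> (nat \<Rightarrow> 'a) \<Rightarrow> bool" where
  "eventually_periodic block a \<longleftrightarrow>
     block \<noteq> [] \<and> (\<exists>N. \<forall>k. a (N + k) = block ! (k mod length block))"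

end

theory Submission
  imports Defs
begin

text \<open>
  Consider the grid of points \<open>(n, n\<alpha> - m - \<gamma>)\<close> and, for consecutive convergents, the basis
  \<open>e\<^sub>k = (q\<^sub>k, q\<^sub>k\<alpha> - p\<^sub>k)\<close>, \<open>e\<^sub>k\<^sub>-\<^sub>1\<close> of the underlying lattice. After rescaling the axes these vectors
  are \<open>(1, -\<theta>\<^sub>k)\<close> and \<open>(\<phi>\<^sub>k, 1)\<close>, where \<open>\<theta>\<^sub>k = [0; a\<^sub>k\<^sub>+\<^sub>1, \<dots>]\<close> and \<open>\<phi>\<^sub>k = [0; a\<^sub>k, \<dots>, a\<^sub>1]\<close>. A grid cell
  at level \<open>k\<close> has the vertices \<open>(\<plusminus>e\<^sub>k \<plusminus> e\<^sub>k\<^sub>-\<^sub>1 + (S\<^sub>k, T\<^sub>k)) / 2\<close>, and passing to the next level is governed by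
  a digit \<open>\<tau>\<^sub>k\<^sub>+\<^sub>1 \<equiv> a\<^sub>k\<^sub>+\<^sub>1 (mod 2)\<close> with \<open>S\<^sub>k\<^sub>+\<^sub>1 = \<phi>\<^sub>k\<^sub>+\<^sub>1(\<tau>\<^sub>k\<^sub>+\<^sub>1 + S\<^sub>k)\<close> and \<open>T\<^sub>k = \<theta>\<^sub>k(\<tau>\<^sub>k\<^sub>+\<^sub>1 - T\<^sub>k\<^sub>+\<^sub>1)\<close>.

  Put \<open>x = 1 / R\<^sub>*\<close>. To first order the smallest of the four vertex products is
  \<open>1/4 (1 - (|\<tau>\<^sub>k| + |\<tau>\<^sub>k\<^sub>+\<^sub>1|) x)\<close>, so a good \<open>\<gamma>\<close> has digits \<open>0\<close> at the even quotients and \<open>\<plusminus>1\<close> at the odd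
  ones. Between two odd quotients the coefficient of \<open>x\<^sup>2 / 4\<close> is then
  \<open>\<tau>\<^sub>k\<^sub>+\<^sub>1\<tau>\<^sub>k\<^sub>+\<^sub>2 - \<tau>\<^sub>k\<^sub>-\<^sub>1\<tau>\<^sub>k - 1\<close>. For four odd digits \<open>o\<^sub>1, \<dots>, o\<^sub>4\<close> between zeros this equals \<open>-2\<close> at
  \<open>(o\<^sub>1, o\<^sub>2)\<close> if \<open>o\<^sub>2o\<^sub>3 = -1\<close>, and at \<open>(o\<^sub>3, o\<^sub>4)\<close> if \<open>o\<^sub>2o\<^sub>3 = 1\<close>, which gives the upper bound. Taking all odd
  digits equal to \<open>1\<close> attains it: along a line of grid points parallel to \<open>e\<^sub>k\<close> through a cell the
  product is concave between its zeros, so no grid point does worse than the cell vertices. For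
  \<open>R\<^sub>* < 1000\<close> the claim is absorbed by \<open>C\<close>, as \<open>0 \<le> \<rho> \<le> 2\<close>.
\<close>

section \<open>Lattice bases from the continued fraction\<close>

lemma cf_convergent_bounds:
  assumes "\<And>i. a i \<ge> 1"
  shows "real_of_int (a 0) \<le> cf_convergent a n \<and> cf_convergent a n \<le> a 0 + 1"
  using assms
proof (induction n arbitrary: a)
  case (Suc n)
  have "real_of_int (a 1) \<le> cf_convergent (\<lambda>i. a (Suc i)) n"
    using Suc.IH[of "\<lambda>i. a (Suc i)"] Suc.prems by simp
  moreover have "real_of_int (a 1) \<ge> 1" using Suc.prems[of 1] by simp
  ultimately show ?case by simp
qed simp

lemma regular_cf_fractional_part:
  assumes "\<alpha> \<notin> \<rat>" "regular_cf \<alpha> a"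
  shows "0 < \<alpha> - a 0" "\<alpha> - a 0 < 1"
proof -
  have "\<alpha> \<noteq> a 0" using assms(1) by auto
  then show "0 < \<alpha> - a 0" "\<alpha> - a 0 < 1" using assms(2) unfolding regular_cf_def by linarith+
qed

lemma irrational_inverse_diff:
  assumes "\<alpha> \<notin> \<rat>"
  shows "1 / (\<alpha> - real_of_int m) \<notin> \<rat>"
proof
  assume "1 / (\<alpha> - real_of_int m) \<in> \<rat>"
  then have "real_of_int m + 1 / (1 / (\<alpha> - m)) \<in> \<rat>"
    by (rule Rats_add[OF Rats_of_int Rats_divide[OF Rats_1]])
  with assms show False by simp
qed

lemma regular_cf_tail:
  assumes irr: "\<alpha> \<notin> \<rat>" and cf: "regular_cf \<alpha> a"
  shows "regular_cf (1 / (\<alpha> - a 0)) (\<lambda>i. a (Suc i))"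
proof -
  define \<beta> where "\<beta> = 1 / (\<alpha> - a 0)"
  have "(\<lambda>n. cf_convergent a (Suc n)) \<longlonglongrightarrow> \<alpha>"
    using cf unfolding regular_cf_def
    by (simp add: filterlim_sequentially_Suc del: cf_convergent.simps)
  then have "(\<lambda>n. 1 / (cf_convergent a (Suc n) - a 0)) \<longlonglongrightarrow> \<beta>"
    unfolding \<beta>_def using regular_cf_fractional_part[OF irr cf] by (intro tendsto_intros) auto
  then have lim: "cf_convergent (\<lambda>i. a (Suc i)) \<longlonglongrightarrow> \<beta>" by simp
  have ge_1: "a (Suc i) \<ge> 1" for i using cf unfolding regular_cf_def by simp
  have bounds: "real_of_int (a 1) \<le> cf_convergent (\<lambda>i. a (Suc i)) n \<and>
      cf_convergent (\<lambda>i. a (Suc i)) n \<le> a 1 + 1" for n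
    using cf_convergent_bounds[of "\<lambda>i. a (Suc i)" n] ge_1 by simp
  have "real_of_int (a 1) \<le> \<beta>" using lim bounds by (intro LIMSEQ_le_const) auto
  moreover have "\<beta> \<le> a 1 + 1" using lim bounds by (intro LIMSEQ_le_const2) auto
  moreover have "\<beta> \<noteq> real_of_int (a 1 + 1)"
    using irrational_inverse_diff[OF irr, of "a 0"] unfolding \<beta>_def by (metis Rats_of_int)
  ultimately have "a 1 = \<lfloor>\<beta>\<rfloor>" by (simp add: floor_unique)
  then show ?thesis using lim ge_1 unfolding regular_cf_def \<beta>_def by simp
qed

locale irrational_cf =
  fixes \<alpha> :: real and a :: "nat \<Rightarrow> int"
  assumes irrational: "\<alpha> \<notin> \<rat>" and cf: "regular_cf \<alpha> a"
begin

primrec \<theta> :: "nat \<Rightarrow> real" where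
  "\<theta> 0 = \<alpha> - a 0"
| "\<theta> (Suc k) = 1 / \<theta> k - a (Suc k)"

text \<open>
  \<open>d\<close> and \<open>Q\<close> are shifted by one: \<open>Q (Suc k) = q\<^sub>k\<close> and \<open>d (Suc k) = q\<^sub>k\<alpha> - p\<^sub>k\<close>, starting from
  \<open>q\<^sub>-\<^sub>1 = 0\<close> and \<open>p\<^sub>-\<^sub>1 = 1\<close>.
\<close>

primrec d :: "nat \<Rightarrow> real" where
  "d 0 = -1"
| "d (Suc k) = - \<theta> k * d k"

fun Q :: "nat \<Rightarrow> int" where
  "Q 0 = 0"
| "Q (Suc 0) = 1"
| "Q (Suc (Suc k)) = a (Suc k) * Q (Suc k) + Q k"

definition \<phi> :: "nat \<Rightarrow> real" where
  "\<phi> k = Q k / Q (Suc k)"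

declare \<theta>.simps(2) [simp del] d.simps(2) [simp del] Q.simps(3) [simp del]

lemma a_ge_1: "a (Suc k) \<ge> 1"
  using cf unfolding regular_cf_def by simp

lemma complete_quotient:
  "\<exists>\<beta>::real. \<theta> k = \<beta> - a k \<and> \<beta> \<notin> \<rat> \<and> regular_cf \<beta> (\<lambda>i. a (k + i))"
proof (induction k)
  case 0
  then show ?case using irrational cf by (intro exI[of _ \<alpha>]) simp
next
  case (Suc k)
  then obtain \<beta> :: real where \<beta>: "\<theta> k = \<beta> - a k" "\<beta> \<notin> \<rat>" "regular_cf \<beta> (\<lambda>i. a (k + i))"
    by blast
  show ?case
    using irrational_inverse_diff[OF \<beta>(2), of "a k"] regular_cf_tail[OF \<beta>(2,3)] \<beta>(1)
    by (intro exI[of _ "1 / (\<beta> - a k)"]) (simp add: \<theta>.simps(2))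
qed

lemma \<theta>_bounds: "0 < \<theta> k" "\<theta> k < 1"
proof -
  obtain \<beta> :: real where "\<theta> k = \<beta> - a k" "\<beta> \<notin> \<rat>" "regular_cf \<beta> (\<lambda>i. a (k + i))"
    using complete_quotient by blast
  with regular_cf_fractional_part[of \<beta>] show "0 < \<theta> k" "\<theta> k < 1" by force+
qed

lemma \<theta>_step: "\<theta> k * (a (Suc k) + \<theta> (Suc k)) = 1"
  using \<theta>_bounds[of k] by (simp add: \<theta>.simps(2))

lemma Q_nonneg: "0 \<le> Q k" and Q_Suc_ge_1: "1 \<le> Q (Suc k)"
proof (induction k)
  case (Suc k)
  have "1 * 1 \<le> a (Suc k) * Q (Suc k)" using a_ge_1[of k] Suc by (intro mult_mono) auto
  then show "1 \<le> Q (Suc (Suc k))" using Suc by (simp add: Q.simps(3))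
qed simp_all

lemma Q_Suc_pos: "0 < real_of_int (Q (Suc k))"
  using Q_Suc_ge_1[of k] by simp

lemma Q_eq: "real_of_int (Q k) = \<phi> k * Q (Suc k)"
  unfolding \<phi>_def using Q_Suc_pos[of k] by simp

lemma \<phi>_step: "\<phi> (Suc k) * (a (Suc k) + \<phi> k) = 1"
proof -
  have "real_of_int (Q (Suc (Suc k))) = (a (Suc k) + \<phi> k) * Q (Suc k)"
    using Q_eq[of k] by (simp add: Q.simps(3) algebra_simps)
  then show ?thesis using Q_Suc_pos[of k] Q_Suc_pos[of "Suc k"] unfolding \<phi>_def[of "Suc k"]
    by (simp add: field_simps)
qed

lemma \<phi>_nonneg: "0 \<le> \<phi> k"
  unfolding \<phi>_def using Q_nonneg[of k] Q_nonneg[of "Suc k"] by simp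

lemma \<phi>_Suc_pos: "0 < \<phi> (Suc k)"
  using \<phi>_step[of k] \<phi>_nonneg[of "Suc k"] by (metis less_eq_real_def mult_zero_left zero_neq_one)

lemma \<phi>_le_1: "\<phi> k \<le> 1"
proof (cases k)
  case (Suc j)
  have "\<phi> (Suc j) * 1 \<le> \<phi> (Suc j) * (a (Suc j) + \<phi> j)"
    using a_ge_1[of j] \<phi>_nonneg by (intro mult_left_mono) (auto simp: add_increasing2)
  then show ?thesis using \<phi>_step[of j] Suc by simp
qed (simp add: \<phi>_def)

lemma \<phi>_\<theta>_nonneg: "0 \<le> \<phi> k * \<theta> k"
  using \<phi>_nonneg[of k] \<theta>_bounds(1)[of k] by simp

lemma d_nonzero: "d k \<noteq> 0"
proof (induction k)
  case (Suc k)
  then show ?case using \<theta>_bounds(1)[of k] by (simp add: d.simps(2))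
qed simp

lemma abs_d_Suc: "\<bar>d (Suc k)\<bar> = \<theta> k * \<bar>d k\<bar>"
  using \<theta>_bounds(1)[of k] by (simp add: d.simps(2) abs_mult)

lemma d_step: "d (Suc (Suc k)) = a (Suc k) * d (Suc k) + d k"
proof -
  have "d k = \<theta> k * (a (Suc k) + \<theta> (Suc k)) * d k" using \<theta>_step[of k] by simp
  then show ?thesis by (simp add: d.simps(2) algebra_simps)
qed

lemma abs_d_step: "\<bar>d k\<bar> = a (Suc k) * \<bar>d (Suc k)\<bar> + \<bar>d (Suc (Suc k))\<bar>"
proof -
  have "\<bar>d k\<bar> = \<theta> k * (a (Suc k) + \<theta> (Suc k)) * \<bar>d k\<bar>" using \<theta>_step[of k] by simp
  then show ?thesis by (simp add: abs_d_Suc algebra_simps)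
qed

lemma lattice_covolume: "Q (Suc k) * \<bar>d k\<bar> * (1 + \<phi> k * \<theta> k) = 1"
proof -
  have "Q (Suc k) * \<bar>d k\<bar> + Q k * \<bar>d (Suc k)\<bar> = 1"
  proof (induction k)
    case (Suc k)
    then show ?case using abs_d_step[of k] by (simp add: Q.simps(3) algebra_simps)
  qed simp
  then show ?thesis unfolding Q_eq[of k] abs_d_Suc by (simp add: algebra_simps)
qed

lemma sum_abs_d_le:
  "(\<Sum>i<n. \<bar>d (Suc (k + i))\<bar>) \<le> \<bar>d k\<bar> + \<bar>d (Suc k)\<bar> - \<bar>d (k + n)\<bar> - \<bar>d (Suc (k + n))\<bar>"
proof (induction n)
  case (Suc n)
  have "1 * \<bar>d (Suc (k + n))\<bar> \<le> a (Suc (k + n)) * \<bar>d (Suc (k + n))\<bar>"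
    using a_ge_1[of "k + n"] by (intro mult_right_mono) auto
  then show ?case using Suc abs_d_step[of "k + n"] by simp
qed simp

lemma summable_abs_d: "summable (\<lambda>i. \<bar>d (Suc (k + i))\<bar>)"
  and suminf_abs_d_le: "(\<Sum>i. \<bar>d (Suc (k + i))\<bar>) \<le> \<bar>d k\<bar> + \<bar>d (Suc k)\<bar>"
proof -
  have le: "(\<Sum>i<n. \<bar>d (Suc (k + i))\<bar>) \<le> \<bar>d k\<bar> + \<bar>d (Suc k)\<bar>" for n
    using sum_abs_d_le[where k = k and n = n] by simp
  show "summable (\<lambda>i. \<bar>d (Suc (k + i))\<bar>)" by (rule summableI_nonneg_bounded[OF _ le]) simp
  then show "(\<Sum>i. \<bar>d (Suc (k + i))\<bar>) \<le> \<bar>d k\<bar> + \<bar>d (Suc k)\<bar>" using le by (rule suminf_le_const)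
qed

lemma d_tendsto_0: "d \<longlonglongrightarrow> 0"
  using summable_LIMSEQ_zero[OF summable_abs_d[of 0]]
  by (simp add: tendsto_rabs_zero_iff filterlim_sequentially_Suc)

lemma Q_at_top: "filterlim (\<lambda>k. real_of_int (Q (Suc k))) at_top sequentially"
proof (rule filterlim_at_top_mono)
  have "((\<lambda>k. 2 * \<bar>d k\<bar>) \<longlongrightarrow> 0) sequentially"
    using tendsto_mult_right_zero[OF tendsto_rabs_zero[OF d_tendsto_0]] by simp
  then show "filterlim (\<lambda>k. inverse (2 * \<bar>d k\<bar>)) at_top sequentially"
    by (rule filterlim_inverse_at_top) (simp add: d_nonzero)
  have "inverse (2 * \<bar>d k\<bar>) \<le> Q (Suc k)" for k
  proof -
    have "1 + \<phi> k * \<theta> k \<le> 1 + 1 * 1"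
      using \<phi>_le_1[of k] \<theta>_bounds[of k] by (intro add_left_mono mult_mono) auto
    then have "Q (Suc k) * \<bar>d k\<bar> * (1 + \<phi> k * \<theta> k) \<le> Q (Suc k) * \<bar>d k\<bar> * 2"
      using Q_Suc_pos[of k] by (intro mult_left_mono) auto
    then show ?thesis using d_nonzero[of k] unfolding lattice_covolume by (simp add: field_simps)
  qed
  then show "\<forall>\<^sub>F k in sequentially. inverse (2 * \<bar>d k\<bar>) \<le> Q (Suc k)" by simp
qed

lemma eventually_Q_gt: "\<forall>\<^sub>F k in sequentially. c < real_of_int (Q (Suc k))"
  using Q_at_top unfolding filterlim_at_top_dense by blast

lemma lattice_point:
  "\<exists>m::int. (i * Q (Suc k) + j * Q k) * \<alpha> - m = i * d (Suc k) + j * d k"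
proof (induction k arbitrary: i j)
  case 0
  show ?case by (intro exI[of _ "i * a 0 + j"]) (simp add: d.simps(2) algebra_simps)
next
  case (Suc k)
  from Suc[of "i * a (Suc k) + j" i] obtain m :: int where
    "((i * a (Suc k) + j) * Q (Suc k) + i * Q k) * \<alpha> - m = (i * a (Suc k) + j) * d (Suc k) + i * d k"
    by (auto simp: algebra_simps)
  then show ?case
    unfolding d_step[of k] by (intro exI[of _ m]) (simp add: Q.simps(3) algebra_simps)
qed

lemma lattice_coords:
  fixes n m :: int
  shows "\<exists>i j::int. n = i * Q (Suc k) + j * Q k \<and> n * \<alpha> - m = i * d (Suc k) + j * d k"
proof (induction k)
  case 0
  show ?case
    by (intro exI[of _ n] exI[of _ "m - n * a 0"]) (simp add: d.simps(2) algebra_simps)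
next
  case (Suc k)
  then obtain i j :: int where ij: "n = i * Q (Suc k) + j * Q k"
    "n * \<alpha> - m = i * d (Suc k) + j * d k" by blast
  show ?case
  proof (intro exI conjI)
    show "n = j * Q (Suc (Suc k)) + (i - j * a (Suc k)) * Q (Suc k)"
      by (simp add: ij(1) Q.simps(3) algebra_simps)
    show "n * \<alpha> - m = j * d (Suc (Suc k)) + (i - j * a (Suc k)) * d (Suc k)"
      unfolding ij(2) d_step by (simp add: algebra_simps)
  qed
qed

end

section \<open>Cells of the grid\<close>

text \<open>
  All coordinates are doubled: \<open>(S, T)\<close> is twice the centre of a cell, and the grid points are those with
  odd integers \<open>I\<close> and \<open>J\<close>.
\<close>

definition cell_product :: "real \<Rightarrow> real \<Rightarrow> real \<Rightarrow> real \<Rightarrow> real \<Rightarrow> real \<Rightarrow> real" where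
  "cell_product \<phi> \<theta> S T I J = \<bar>I + J * \<phi> + S\<bar> * \<bar>J - I * \<theta> + T\<bar> / (1 + \<phi> * \<theta>)"

lemma cell_product_uminus: "cell_product \<phi> \<theta> (- S) (- T) (- I) (- J) = cell_product \<phi> \<theta> S T I J"
proof -
  have "- I + - J * \<phi> + - S = - (I + J * \<phi> + S)" "- J - - I * \<theta> + - T = - (J - I * \<theta> + T)"
    by simp_all
  then show ?thesis unfolding cell_product_def by (simp only: abs_minus_cancel)
qed

definition vertices_ge :: "real \<Rightarrow> real \<Rightarrow> real \<Rightarrow> real \<Rightarrow> real \<Rightarrow> bool" where
  "vertices_ge b \<phi> \<theta> S T \<longleftrightarrow> (\<forall>s\<in>{1, -1}. \<forall>t\<in>{1, -1}. b \<le> cell_product \<phi> \<theta> S T s t)"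

lemma vertices_ge_uminus: "vertices_ge b \<phi> \<theta> (- S) (- T) \<longleftrightarrow> vertices_ge b \<phi> \<theta> S T"
  unfolding vertices_ge_def using cell_product_uminus[of \<phi> \<theta> S T] by (auto; metis minus_minus)

context irrational_cf begin

definition coord_X :: "nat \<Rightarrow> int \<Rightarrow> real" where
  "coord_X k n = 2 * n / Q (Suc k)"

definition coord_Y :: "real \<Rightarrow> nat \<Rightarrow> int \<Rightarrow> int \<Rightarrow> real" where
  "coord_Y \<gamma> k n m = 2 * (n * \<alpha> - m - \<gamma>) / d k"

definition cell :: "real \<Rightarrow> nat \<Rightarrow> real \<Rightarrow> real \<Rightarrow> bool" where
  "cell \<gamma> k S T \<longleftrightarrow> (\<exists>n m. coord_X k n = 1 + \<phi> k + S \<and> coord_Y \<gamma> k n m = 1 - \<theta> k + T)"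

lemma coord_X_Suc: "coord_X (Suc k) n = \<phi> (Suc k) * coord_X k n"
  unfolding coord_X_def \<phi>_def using Q_Suc_pos[of k] by simp

lemma coord_Y_Suc: "coord_Y \<gamma> k n m = - \<theta> k * coord_Y \<gamma> (Suc k) n m"
  unfolding coord_Y_def using \<theta>_bounds(1)[of k] by (simp add: d.simps(2))

lemma coord_product:
  "4 * (\<bar>real_of_int n\<bar> * \<bar>n * \<alpha> - m - \<gamma>\<bar>) = \<bar>coord_X k n\<bar> * \<bar>coord_Y \<gamma> k n m\<bar> / (1 + \<phi> k * \<theta> k)"
proof -
  have "\<bar>2 * u / q\<bar> * \<bar>2 * v / e\<bar> * (q * \<bar>e\<bar>) = 4 * (\<bar>u\<bar> * \<bar>v\<bar>)" if "0 < q" "e \<noteq> 0" for u v q e :: real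
    using that by (simp add: abs_mult)
  from this[OF Q_Suc_pos d_nonzero]
  have "\<bar>coord_X k n\<bar> * \<bar>coord_Y \<gamma> k n m\<bar> * (Q (Suc k) * \<bar>d k\<bar>) =
      4 * (\<bar>real_of_int n\<bar> * \<bar>n * \<alpha> - m - \<gamma>\<bar>)"
    unfolding coord_X_def coord_Y_def .
  moreover have "Q (Suc k) * \<bar>d k\<bar> = 1 / (1 + \<phi> k * \<theta> k)"
    using lattice_covolume[of k] \<phi>_\<theta>_nonneg[of k] by (simp add: field_simps)
  ultimately show ?thesis by simp
qed

lemma grid_product:
  fixes I J S T :: real
  assumes "coord_X k n = I + J * \<phi> k + S" "coord_Y \<gamma> k n m = J - I * \<theta> k + T"
  shows "4 * (\<bar>real_of_int n\<bar> * \<bar>n * \<alpha> - m - \<gamma>\<bar>) = cell_product (\<phi> k) (\<theta> k) S T I J"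
  unfolding cell_product_def coord_product[of n m \<gamma> k] assms ..

lemma coord_translate:
  "\<exists>n' m'. coord_X k n' = coord_X k n + 2 * (real_of_int i + real_of_int j * \<phi> k) \<and>
    coord_Y \<gamma> k n' m' = coord_Y \<gamma> k n m + 2 * (real_of_int j - real_of_int i * \<theta> k)"
proof -
  obtain m' :: int where m': "(i * Q (Suc k) + j * Q k) * \<alpha> - m' = i * d (Suc k) + j * d k"
    using lattice_point by blast
  have "coord_X k (n + (i * Q (Suc k) + j * Q k)) = coord_X k n + 2 * (i + j * \<phi> k)"
    unfolding coord_X_def \<phi>_def using Q_Suc_pos[of k] by (simp add: field_simps)
  moreover have "coord_Y \<gamma> k (n + (i * Q (Suc k) + j * Q k)) (m + m') =
      2 * ((n * \<alpha> - m - \<gamma>) + (i * d (Suc k) + j * d k)) / d k"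
    unfolding coord_Y_def m'[symmetric] by (simp add: algebra_simps)
  then have "coord_Y \<gamma> k (n + (i * Q (Suc k) + j * Q k)) (m + m') =
      coord_Y \<gamma> k n m + 2 * (j - i * \<theta> k)"
    unfolding coord_Y_def using d_nonzero[of k] by (simp add: d.simps(2) field_simps)
  ultimately show ?thesis by blast
qed

lemma coord_difference:
  obtains i j :: int where "coord_X k n' = coord_X k n + 2 * (i + j * \<phi> k)"
    "coord_Y \<gamma> k n' m' = coord_Y \<gamma> k n m + 2 * (j - i * \<theta> k)"
proof -
  obtain i j :: int where ij: "n' - n = i * Q (Suc k) + j * Q k"
    "real_of_int (n' - n) * \<alpha> - real_of_int (m' - m) = i * d (Suc k) + j * d k"
    using lattice_coords by blast
  have "real_of_int n' = n + (i * Q (Suc k) + j * Q k)"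
    using arg_cong[OF ij(1), of real_of_int] by simp
  then have "coord_X k n' = coord_X k n + 2 * (i + j * \<phi> k)"
    unfolding coord_X_def \<phi>_def using Q_Suc_pos[of k] by (simp add: field_simps)
  moreover have "n' * \<alpha> - m' - \<gamma> = (n * \<alpha> - m - \<gamma>) + (i * d (Suc k) + j * d k)"
    using ij(2) by (simp add: algebra_simps)
  then have "coord_Y \<gamma> k n' m' = coord_Y \<gamma> k n m + 2 * (j - i * \<theta> k)"
    unfolding coord_Y_def using d_nonzero[of k] by (simp add: d.simps(2) field_simps)
  ultimately show ?thesis using that by blast
qed

lemma cell_point:
  fixes I J :: int and S T :: real
  assumes "cell \<gamma> k S T" "odd I" "odd J"
  obtains n m where "coord_X k n = I + J * \<phi> k + S" "coord_Y \<gamma> k n m = J - I * \<theta> k + T"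
proof -
  obtain i j where I: "I = 2 * i + 1" and J: "J = 2 * j + 1" using assms(2,3) by (auto elim!: oddE)
  obtain n0 m0 where "coord_X k n0 = 1 + \<phi> k + S" "coord_Y \<gamma> k n0 m0 = 1 - \<theta> k + T"
    using assms(1) unfolding cell_def by blast
  with coord_translate[of k n0 i j \<gamma> m0] show ?thesis
    using that unfolding I J by (auto simp: algebra_simps)
qed

lemma cell_coords:
  fixes S T :: real
  assumes "cell \<gamma> k S T"
  obtains I J :: int where "odd I" "odd J"
    "coord_X k n = I + J * \<phi> k + S" "coord_Y \<gamma> k n m = J - I * \<theta> k + T"
proof -
  obtain n0 m0 where nm0: "coord_X k n0 = 1 + \<phi> k + S" "coord_Y \<gamma> k n0 m0 = 1 - \<theta> k + T"
    using assms unfolding cell_def by blast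
  obtain i j :: int where "coord_X k n = coord_X k n0 + 2 * (i + j * \<phi> k)"
    "coord_Y \<gamma> k n m = coord_Y \<gamma> k n0 m0 + 2 * (j - i * \<theta> k)"
    by (rule coord_difference)
  with nm0 that[of "2 * i + 1" "2 * j + 1"] show ?thesis by (simp add: algebra_simps)
qed

lemma cell_exists:
  obtains \<xi> \<eta> :: real where "\<bar>\<xi>\<bar> \<le> 1" "\<bar>\<eta>\<bar> \<le> 1" "cell \<gamma> k (\<xi> + \<eta> * \<phi> k) (\<eta> - \<xi> * \<theta> k)"
proof -
  define v where "v = - \<gamma> / (d k * (1 + \<phi> k * \<theta> k))"
  define u where "u = - v * \<phi> k"
  define \<xi> \<eta> where "\<xi> = 2 * frac u - 1" and "\<eta> = 2 * frac v - 1"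
  have "- \<gamma> / d k = v * (1 + \<phi> k * \<theta> k)" unfolding v_def using \<phi>_\<theta>_nonneg[of k] by simp
  then have "- \<gamma> / d k = v - u * \<theta> k" unfolding u_def by (simp add: algebra_simps)
  then have "coord_X k 0 = 2 * (u + v * \<phi> k)" "coord_Y \<gamma> k 0 0 = 2 * (v - u * \<theta> k)"
    unfolding coord_X_def coord_Y_def u_def by simp_all
  with coord_translate[of k 0 "- \<lfloor>u\<rfloor>" "- \<lfloor>v\<rfloor>" \<gamma> 0]
  have "cell \<gamma> k (\<xi> + \<eta> * \<phi> k) (\<eta> - \<xi> * \<theta> k)"
    unfolding cell_def \<xi>_def \<eta>_def frac_def by (simp add: algebra_simps)
  moreover have "\<bar>\<xi>\<bar> \<le> 1" "\<bar>\<eta>\<bar> \<le> 1"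
    using frac_ge_0[of u] frac_lt_1[of u] frac_ge_0[of v] frac_lt_1[of v]
    unfolding \<xi>_def \<eta>_def by (simp_all only: abs_le_iff) linarith+
  ultimately show ?thesis using that by blast
qed

text \<open>
  The lattice vector with coordinates \<open>(I, J)\<close> at level \<open>k + 1\<close> has coordinates \<open>(a\<^sub>k\<^sub>+\<^sub>1I + J, I)\<close> at level \<open>k\<close>.
\<close>

lemma cell_coords_Suc:
  fixes I J \<tau> S T S' T' :: real
  assumes "S' = \<phi> (Suc k) * (\<tau> + S)" "T = \<theta> k * (\<tau> - T')"
  shows "I + J * \<phi> (Suc k) + S' = \<phi> (Suc k) * ((a (Suc k) * I + J + \<tau>) + I * \<phi> k + S)"
    and "I - (a (Suc k) * I + J + \<tau>) * \<theta> k + T = - \<theta> k * (J - I * \<theta> (Suc k) + T')"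
proof -
  have "I = \<phi> (Suc k) * (a (Suc k) + \<phi> k) * I" using \<phi>_step[of k] by simp
  then show "I + J * \<phi> (Suc k) + S' = \<phi> (Suc k) * ((a (Suc k) * I + J + \<tau>) + I * \<phi> k + S)"
    unfolding assms(1) by (simp add: algebra_simps)
  have "I = \<theta> k * (a (Suc k) + \<theta> (Suc k)) * I" using \<theta>_step[of k] by simp
  then show "I - (a (Suc k) * I + J + \<tau>) * \<theta> k + T = - \<theta> k * (J - I * \<theta> (Suc k) + T')"
    unfolding assms(2) by (simp add: algebra_simps)
qed

lemma cell_product_Suc:
  fixes I J \<tau> S T S' T' :: real
  assumes "S' = \<phi> (Suc k) * (\<tau> + S)" "T = \<theta> k * (\<tau> - T')"
  shows "cell_product (\<phi> k) (\<theta> k) S T (a (Suc k) * I + J + \<tau>) I =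
    cell_product (\<phi> (Suc k)) (\<theta> (Suc k)) S' T' I J"
proof -
  have "\<phi> (Suc k) * (1 + \<phi> k * \<theta> k) = \<theta> k * (1 + \<phi> (Suc k) * \<theta> (Suc k))"
    using \<theta>_step[of k] \<phi>_step[of k] by algebra
  then have scale: "\<theta> k / (1 + \<phi> k * \<theta> k) = \<phi> (Suc k) / (1 + \<phi> (Suc k) * \<theta> (Suc k))"
    using \<phi>_\<theta>_nonneg[of k] \<phi>_\<theta>_nonneg[of "Suc k"] by (simp add: frac_eq_eq)
  define x y where "x = a (Suc k) * I + J + \<tau> + I * \<phi> k + S" and "y = J - I * \<theta> (Suc k) + T'"
  have "cell_product (\<phi> k) (\<theta> k) S T (a (Suc k) * I + J + \<tau>) I =
      \<theta> k / (1 + \<phi> k * \<theta> k) * (\<bar>x\<bar> * \<bar>y\<bar>)"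
    unfolding cell_product_def cell_coords_Suc(2)[OF assms] x_def y_def
    using \<theta>_bounds(1)[of k] by (simp add: abs_mult)
  also have "\<dots> = cell_product (\<phi> (Suc k)) (\<theta> (Suc k)) S' T' I J"
    unfolding scale cell_product_def cell_coords_Suc(1)[OF assms] x_def y_def
    using \<phi>_Suc_pos[of k] by (simp add: abs_mult)
  finally show ?thesis .
qed

lemma cell_Suc:
  fixes \<tau> :: int and S T S' T' :: real
  assumes "cell \<gamma> k S T" "S' = \<phi> (Suc k) * (\<tau> + S)" "T = \<theta> k * (\<tau> - T')" "even (a (Suc k) + \<tau>)"
  shows "cell \<gamma> (Suc k) S' T'"
proof -
  have "odd (a (Suc k) + 1 + \<tau>)" using assms(4) by presburger
  then obtain n m where X: "coord_X k n = (a (Suc k) + 1 + \<tau>) + 1 * \<phi> k + S"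
    and Y: "coord_Y \<gamma> k n m = 1 - (a (Suc k) + 1 + \<tau>) * \<theta> k + T"
    using cell_point[OF assms(1), of "a (Suc k) + 1 + \<tau>" 1] by auto
  note Suc_coords = cell_coords_Suc[OF assms(2,3), of 1 1]
  have "coord_X (Suc k) n = 1 + \<phi> (Suc k) + S'" using Suc_coords(1) by (simp add: coord_X_Suc X)
  moreover have "- \<theta> k * coord_Y \<gamma> (Suc k) n m = - \<theta> k * (1 - \<theta> (Suc k) + T')"
    using Suc_coords(2) Y unfolding coord_Y_Suc[of \<gamma> k] by simp
  then have "coord_Y \<gamma> (Suc k) n m = 1 - \<theta> (Suc k) + T'"
    using \<theta>_bounds(1)[of k] by (simp only: mult_cancel_left) simp
  ultimately show ?thesis unfolding cell_def by blast
qed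

lemma cell_transition:
  fixes S T S' T' :: real
  assumes "cell \<gamma> k S T" "cell \<gamma> (Suc k) S' T'"
  obtains \<tau> e :: int where "S' = \<phi> (Suc k) * (\<tau> + S + e * \<phi> k)" "T = \<theta> k * (\<tau> - T') - e"
    "even (a (Suc k) + \<tau>)" "even e"
proof -
  obtain n m where nm: "coord_X (Suc k) n = 1 + \<phi> (Suc k) + S'"
    "coord_Y \<gamma> (Suc k) n m = 1 - \<theta> (Suc k) + T'"
    using assms(2) unfolding cell_def by blast
  obtain I J :: int where IJ: "odd I" "odd J"
    "coord_X k n = I + J * \<phi> k + S" "coord_Y \<gamma> k n m = J - I * \<theta> k + T"
    by (rule cell_coords[OF assms(1)])
  define \<tau> e where "\<tau> = I - 1 - a (Suc k)" and "e = J - 1"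
  have "1 + \<phi> (Suc k) + S' = \<phi> (Suc k) * (I + J * \<phi> k + S)"
    using nm(1) IJ(3) by (simp add: coord_X_Suc)
  then have "S' = \<phi> (Suc k) * (\<tau> + S + e * \<phi> k)"
    using \<phi>_step[of k] by (simp add: \<tau>_def e_def algebra_simps)
  moreover have "- \<theta> k * (1 - \<theta> (Suc k) + T') = J - I * \<theta> k + T"
    using nm(2) IJ(4) by (simp add: coord_Y_Suc[of \<gamma> k])
  then have "T = \<theta> k * (\<tau> - T') - e"
    using \<theta>_step[of k] by (simp add: \<tau>_def e_def algebra_simps)
  moreover have "even (a (Suc k) + \<tau>)" "even e" using IJ(1,2) unfolding \<tau>_def e_def by simp_all
  ultimately show ?thesis by (rule that)
qed

lemma cell_digit:
  fixes S T S' T' :: real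
  assumes cells: "cell \<gamma> k S T" "cell \<gamma> (Suc k) S' T'"
    and small: "\<theta> k * (\<bar>S'\<bar> / \<phi> (Suc k) + \<bar>S\<bar> + \<bar>T'\<bar>) + \<bar>T\<bar> < 2"
  obtains \<tau> :: int where "S' = \<phi> (Suc k) * (\<tau> + S)" "T = \<theta> k * (\<tau> - T')" "even (a (Suc k) + \<tau>)"
proof -
  obtain \<tau> e :: int where S': "S' = \<phi> (Suc k) * (\<tau> + S + e * \<phi> k)" and T: "T = \<theta> k * (\<tau> - T') - e"
    and even: "even (a (Suc k) + \<tau>)" "even e"
    using cells by (rule cell_transition)
  have "S' / \<phi> (Suc k) = \<tau> + S + e * \<phi> k" unfolding S' using \<phi>_Suc_pos[of k] by simp
  then have "e * (1 + \<phi> k * \<theta> k) = \<theta> k * (S' / \<phi> (Suc k) - S - T') - T"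
    unfolding T by (simp add: algebra_simps)
  moreover have "\<bar>S' / \<phi> (Suc k) - S - T'\<bar> \<le> \<bar>S'\<bar> / \<phi> (Suc k) + \<bar>S\<bar> + \<bar>T'\<bar>"
    using \<phi>_Suc_pos[of k] abs_divide[of S' "\<phi> (Suc k)"] by linarith
  then have "\<bar>\<theta> k * (S' / \<phi> (Suc k) - S - T')\<bar> \<le> \<theta> k * (\<bar>S'\<bar> / \<phi> (Suc k) + \<bar>S\<bar> + \<bar>T'\<bar>)"
    using \<theta>_bounds(1)[of k] by (simp add: abs_mult)
  ultimately have "\<bar>e * (1 + \<phi> k * \<theta> k)\<bar> < 2" using small by linarith
  moreover have "\<bar>real_of_int e\<bar> * 1 \<le> \<bar>e * (1 + \<phi> k * \<theta> k)\<bar>"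
    unfolding abs_mult using \<phi>_\<theta>_nonneg[of k] by (intro mult_left_mono) auto
  ultimately have "\<bar>e\<bar> < 2" by linarith
  with even(2) have "e = 0" by presburger
  then show ?thesis using that[of \<tau>] S' T even(1) by simp
qed

end

section \<open>Grid points and the approximation constant\<close>

abbreviation int_span :: "real \<Rightarrow> real set" where
  "int_span \<alpha> \<equiv> {real_of_int m + real_of_int k * \<alpha> | m k. True}"

lemma dist_int_le: "dist_int x \<le> \<bar>x - of_int m\<bar>"
  unfolding dist_int_def using infdist_le[of "of_int m" \<int> x] by (simp add: dist_real_def)

lemma dist_int_geI:
  assumes "\<And>m::int. b \<le> \<bar>x - of_int m\<bar>"
  shows "b \<le> dist_int x"
proof -
  have "b \<le> (INF z\<in>\<int>. dist x z)"
    using assms by (intro cINF_greatest) (auto simp: dist_real_def elim!: Ints_cases)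
  then show ?thesis unfolding dist_int_def by (subst infdist_notempty) auto
qed

lemma dist_int_shift_pos:
  assumes "\<gamma> \<notin> int_span \<alpha>"
  shows "0 < dist_int (of_int n * \<alpha> - \<gamma>)"
proof -
  have "of_int n * \<alpha> - \<gamma> \<notin> \<int>"
  proof
    assume "of_int n * \<alpha> - \<gamma> \<in> \<int>"
    then obtain m :: int where "of_int n * \<alpha> - \<gamma> = m" by (rule Ints_cases)
    then have "\<gamma> = real_of_int (- m) + real_of_int n * \<alpha>" by simp
    with assms show False by blast
  qed
  then show ?thesis unfolding dist_int_def by (rule infdist_pos_not_in_closed[rotated 2]) auto
qed

lemma approx_const_geI:
  fixes N :: int and b \<alpha> \<gamma> :: real
  assumes "\<And>n m :: int. N \<le> \<bar>n\<bar> \<Longrightarrow> b \<le> \<bar>real_of_int n\<bar> * \<bar>n * \<alpha> - m - \<gamma>\<bar>"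
  shows "ereal b \<le> approx_const \<alpha> \<gamma>"
  unfolding approx_const_def
proof (rule Liminf_bounded, unfold eventually_filtercomap_at_top_linorder, intro exI allI impI)
  fix n :: int assume n: "max N 1 \<le> \<bar>n\<bar>"
  then have pos: "0 < \<bar>real_of_int n\<bar>" by auto
  have "b / \<bar>real_of_int n\<bar> \<le> dist_int (n * \<alpha> - \<gamma>)"
  proof (rule dist_int_geI)
    fix m :: int
    have "b \<le> \<bar>real_of_int n\<bar> * \<bar>n * \<alpha> - m - \<gamma>\<bar>" using assms n by auto
    then show "b / \<bar>real_of_int n\<bar> \<le> \<bar>n * \<alpha> - \<gamma> - m\<bar>"
      using pos by (simp add: divide_le_eq mult.commute algebra_simps)
  qed
  then show "ereal b \<le> ereal (\<bar>real_of_int n\<bar> * dist_int (n * \<alpha> - \<gamma>))"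
    using pos by (simp add: divide_le_eq mult.commute)
qed

lemma approx_const_le_rho: "\<gamma> \<notin> int_span \<alpha> \<Longrightarrow> approx_const \<alpha> \<gamma> \<le> rho \<alpha>"
  unfolding rho_def by (rule SUP_upper) simp

lemma rho_leI: "(\<And>\<gamma>. \<gamma> \<notin> int_span \<alpha> \<Longrightarrow> approx_const \<alpha> \<gamma> \<le> b) \<Longrightarrow> rho \<alpha> \<le> b"
  unfolding rho_def by (rule SUP_least) simp

lemma rho_nonneg: "0 \<le> rho \<alpha>"
proof -
  have "int_span \<alpha> = (\<lambda>(m, k). real_of_int m + real_of_int k * \<alpha>) ` UNIV" by auto
  then have "countable (int_span \<alpha>)" by simp
  then have "int_span \<alpha> \<noteq> UNIV" using uncountable_UNIV_real by metis
  then obtain \<gamma> where "\<gamma> \<notin> int_span \<alpha>" by blast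
  moreover have "ereal 0 \<le> approx_const \<alpha> \<gamma>" by (rule approx_const_geI[where N = 0]) simp
  ultimately show ?thesis using approx_const_le_rho[of \<gamma> \<alpha>] unfolding zero_ereal_def
    by (blast intro: order_trans)
qed

context irrational_cf begin

definition grid_large :: "real \<Rightarrow> real \<Rightarrow> nat \<Rightarrow> bool" where
  "grid_large \<gamma> b k \<longleftrightarrow> (\<forall>(n::int) (m::int). \<bar>n * \<alpha> - m - \<gamma>\<bar> \<le> 2 * \<bar>d k\<bar> \<longrightarrow>
    b < 4 * (\<bar>real_of_int n\<bar> * \<bar>n * \<alpha> - m - \<gamma>\<bar>))"

lemma eventually_grid_large:
  assumes \<gamma>: "\<gamma> \<notin> int_span \<alpha>" and b: "ereal (b / 4) < approx_const \<alpha> \<gamma>"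
  shows "\<forall>\<^sub>F k in sequentially. grid_large \<gamma> b k"
proof -
  have "\<forall>\<^sub>F n in filtercomap abs at_top. ereal (b / 4) < ereal (\<bar>real_of_int n\<bar> * dist_int (n * \<alpha> - \<gamma>))"
    using b unfolding approx_const_def by (rule less_LiminfD)
  then obtain N :: int where N: "\<And>n. N \<le> \<bar>n\<bar> \<Longrightarrow> b / 4 < \<bar>real_of_int n\<bar> * dist_int (n * \<alpha> - \<gamma>)"
    unfolding eventually_filtercomap_at_top_linorder by auto
  have "\<forall>\<^sub>F k in sequentially. 2 * \<bar>d k\<bar> < dist_int (n * \<alpha> - \<gamma>)" for n :: int
    using tendsto_mult_right_zero[OF tendsto_rabs_zero[OF d_tendsto_0], of 2] dist_int_shift_pos[OF \<gamma>]
    by (intro order_tendstoD)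
  then have "\<forall>\<^sub>F k in sequentially. \<forall>n\<in>{-N..N}. 2 * \<bar>d k\<bar> < dist_int (n * \<alpha> - \<gamma>)"
    by (intro eventually_ball_finite) auto
  then show ?thesis
  proof eventually_elim
    case (elim k)
    show ?case unfolding grid_large_def
    proof (intro allI impI)
      fix n m :: int assume y: "\<bar>n * \<alpha> - m - \<gamma>\<bar> \<le> 2 * \<bar>d k\<bar>"
      have dist: "dist_int (n * \<alpha> - \<gamma>) \<le> \<bar>n * \<alpha> - m - \<gamma>\<bar>"
        using dist_int_le[of "n * \<alpha> - \<gamma>" m] by (simp add: algebra_simps)
      with y elim have "n \<notin> {-N..N}" by force
      then have "b / 4 < \<bar>real_of_int n\<bar> * dist_int (n * \<alpha> - \<gamma>)" by (intro N) auto
      also have "\<dots> \<le> \<bar>real_of_int n\<bar> * \<bar>n * \<alpha> - m - \<gamma>\<bar>" using dist by (intro mult_left_mono) auto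
      finally show "b < 4 * (\<bar>real_of_int n\<bar> * \<bar>n * \<alpha> - m - \<gamma>\<bar>)" by simp
    qed
  qed
qed

lemma cell_product_gt_if_grid_large:
  fixes I J :: int and S T :: real
  assumes "grid_large \<gamma> b k" "cell \<gamma> k S T" "odd I" "odd J" and Y: "\<bar>J - I * \<theta> k + T\<bar> \<le> 4"
  shows "b < cell_product (\<phi> k) (\<theta> k) S T I J"
proof -
  obtain n m where nm: "coord_X k n = I + J * \<phi> k + S" "coord_Y \<gamma> k n m = J - I * \<theta> k + T"
    using cell_point[OF assms(2-4)] .
  have "\<bar>coord_Y \<gamma> k n m\<bar> \<le> 4" using Y nm(2) by simp
  then have "\<bar>n * \<alpha> - m - \<gamma>\<bar> \<le> 2 * \<bar>d k\<bar>"
    unfolding coord_Y_def using d_nonzero[of k] by (simp add: abs_mult divide_le_eq)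
  then show ?thesis using assms(1) unfolding grid_large_def grid_product[OF nm, symmetric] by simp
qed

lemma vertices_ge_if_grid_large:
  assumes "grid_large \<gamma> b k" "cell \<gamma> k S T" "\<bar>T\<bar> \<le> 2"
  shows "vertices_ge b (\<phi> k) (\<theta> k) S T"
  unfolding vertices_ge_def
proof (intro ballI)
  fix s t :: real assume st: "s \<in> {1, -1}" "t \<in> {1, -1}"
  then obtain s' t' :: int where st': "s = s'" "t = t'" "odd s'" "odd t'"
    by (metis insertE odd_one of_int_1 of_int_minus even_minus singletonD)
  have "\<bar>t - s * \<theta> k + T\<bar> \<le> 4" using st assms(3) \<theta>_bounds[of k] by auto
  then show "b \<le> cell_product (\<phi> k) (\<theta> k) S T s t"
    unfolding st' using cell_product_gt_if_grid_large[OF assms(1,2) st'(3,4)]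
    by (simp add: less_imp_le)
qed

lemma approx_const_le_2:
  assumes "\<gamma> \<notin> int_span \<alpha>"
  shows "approx_const \<alpha> \<gamma> \<le> ereal 2"
proof (rule ccontr)
  assume "\<not> ?thesis"
  then have "ereal (8 / 4) < approx_const \<alpha> \<gamma>" by simp
  then obtain k where large: "grid_large \<gamma> 8 k"
    using eventually_grid_large[OF assms] unfolding eventually_sequentially by blast
  obtain \<xi> \<eta> where \<xi>\<eta>: "\<bar>\<xi>\<bar> \<le> 1" "\<bar>\<eta>\<bar> \<le> 1" and cell: "cell \<gamma> k (\<xi> + \<eta> * \<phi> k) (\<eta> - \<xi> * \<theta> k)"
    by (rule cell_exists)
  define X Y where "X = 1 + 1 * \<phi> k + (\<xi> + \<eta> * \<phi> k)" and "Y = 1 - 1 * \<theta> k + (\<eta> - \<xi> * \<theta> k)"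
  have "\<bar>1 + \<xi>\<bar> \<le> 2" "\<bar>1 + \<eta>\<bar> \<le> 2" using \<xi>\<eta> by linarith+
  have X: "\<bar>X\<bar> \<le> 4"
  proof -
    have "\<bar>(1 + \<eta>) * \<phi> k\<bar> \<le> 2 * 1"
      unfolding abs_mult using \<xi>\<eta> \<phi>_nonneg[of k] \<phi>_le_1[of k] by (intro mult_mono) auto
    moreover have "X = (1 + \<xi>) + (1 + \<eta>) * \<phi> k" unfolding X_def by (simp add: algebra_simps)
    ultimately show ?thesis using \<open>\<bar>1 + \<xi>\<bar> \<le> 2\<close> by linarith
  qed
  have Y: "\<bar>Y\<bar> \<le> 2"
  proof -
    have "0 \<le> (1 + \<xi>) * \<theta> k" using \<xi>\<eta> \<theta>_bounds[of k] by (intro mult_nonneg_nonneg) auto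
    moreover have "(1 + \<xi>) * \<theta> k \<le> 2 * 1" using \<xi>\<eta> \<theta>_bounds[of k] by (intro mult_mono) auto
    moreover have "Y = (1 + \<eta>) - (1 + \<xi>) * \<theta> k" unfolding Y_def by (simp add: algebra_simps)
    ultimately show ?thesis using \<xi>\<eta> by linarith
  qed
  have "8 < \<bar>X\<bar> * \<bar>Y\<bar> / (1 + \<phi> k * \<theta> k)"
    using cell_product_gt_if_grid_large[OF large cell, of 1 1] Y
    unfolding cell_product_def X_def Y_def by simp
  also have "\<dots> \<le> \<bar>X\<bar> * \<bar>Y\<bar> / 1" using \<phi>_\<theta>_nonneg[of k] by (intro divide_left_mono) auto
  also have "\<dots> \<le> 4 * 2" unfolding div_by_1 using X Y by (intro mult_mono) auto
  finally show False by simp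
qed

lemma rho_le_2: "rho \<alpha> \<le> ereal 2"
  by (rule rho_leI) (rule approx_const_le_2)

end

section \<open>Digit sequences\<close>

locale digit_sequence = irrational_cf +
  fixes M :: nat and \<tau> :: "nat \<Rightarrow> int" and S T :: "nat \<Rightarrow> real"
  assumes S_Suc: "M \<le> k \<Longrightarrow> S (Suc k) = \<phi> (Suc k) * (\<tau> (Suc k) + S k)"
    and T_eq: "M \<le> k \<Longrightarrow> T k = \<theta> k * (\<tau> (Suc k) - T (Suc k))"
    and parity: "M \<le> k \<Longrightarrow> even (a (Suc k) + \<tau> (Suc k))"
begin

lemma cell_at:
  assumes "cell \<gamma> M (S M) (T M)" "M \<le> k"
  shows "cell \<gamma> k (S k) (T k)"
  using assms(2)
proof (induction k rule: dec_induct)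
  case (step k)
  show ?case
    using cell_Suc[OF step.IH S_Suc[OF step.hyps(1)] T_eq[OF step.hyps(1)] parity[OF step.hyps(1)]] .
qed (rule assms(1))

end

context irrational_cf begin

lemma forward_digits_exist:
  fixes \<tau> :: "nat \<Rightarrow> int"
  assumes "\<And>k. \<bar>\<tau> k\<bar> \<le> 1"
  obtains S :: "nat \<Rightarrow> real" where "S 0 = 1" "\<forall>k. S (Suc k) = \<phi> (Suc k) * (\<tau> (Suc k) + S k)"
    "\<forall>k. \<bar>S k\<bar> \<le> 1 + \<phi> k"
proof -
  define S where "S = rec_nat 1 (\<lambda>k s. \<phi> (Suc k) * (\<tau> (Suc k) + s))"
  have S_0: "S 0 = 1" and S_Suc: "S (Suc k) = \<phi> (Suc k) * (\<tau> (Suc k) + S k)" for k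
    unfolding S_def by simp_all
  have "\<bar>S k\<bar> \<le> 1 + \<phi> k" for k
  proof (induction k)
    case (Suc k)
    have "\<bar>real_of_int (\<tau> (Suc k))\<bar> \<le> 1" using assms[of "Suc k"] by linarith
    then have "\<bar>\<tau> (Suc k) + S k\<bar> \<le> 1 + (a (Suc k) + \<phi> k)" using Suc a_ge_1[of k] by linarith
    then have "\<bar>S (Suc k)\<bar> \<le> \<phi> (Suc k) * (1 + (a (Suc k) + \<phi> k))"
      unfolding S_Suc abs_mult using \<phi>_nonneg[of "Suc k"] by (intro mult_mono) auto
    then show ?case using \<phi>_step[of k] by (simp add: algebra_simps)
  qed (simp add: S_0 \<phi>_nonneg)
  then show ?thesis using that[of S] S_0 S_Suc by blast
qed

lemma backward_digits_exist:
  fixes \<tau> :: "nat \<Rightarrow> int"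
  assumes "\<And>k. \<bar>\<tau> k\<bar> \<le> 1"
  obtains T :: "nat \<Rightarrow> real" where "\<forall>k. T k = \<theta> k * (\<tau> (Suc k) - T (Suc k))"
    "\<forall>k. \<bar>T k\<bar> \<le> 1 + \<theta> k"
proof -
  define t where "t k = (\<Sum>i. \<tau> (Suc (k + i)) * d (Suc (k + i)))" for k
  have term_le: "norm (\<tau> (Suc (k + i)) * d (Suc (k + i))) \<le> \<bar>d (Suc (k + i))\<bar>" for k i
  proof -
    have "\<bar>real_of_int (\<tau> (Suc (k + i)))\<bar> \<le> 1" using assms[of "Suc (k + i)"] by linarith
    then show ?thesis by (simp add: abs_mult mult_left_le_one_le)
  qed
  have "summable (\<lambda>i. \<tau> (Suc (k + i)) * d (Suc (k + i)))" for k
    using term_le by (intro summable_comparison_test[OF _ summable_abs_d[of k]]) blast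
  then have t_step: "t k = \<tau> (Suc k) * d (Suc k) + t (Suc k)" for k
    using suminf_split_head[of "\<lambda>i. \<tau> (Suc (k + i)) * d (Suc (k + i))"] unfolding t_def by simp
  have t_le: "\<bar>t k\<bar> \<le> (1 + \<theta> k) * \<bar>d k\<bar>" for k
    using norm_suminf_le[OF term_le[of k] summable_abs_d] suminf_abs_d_le[of k]
    unfolding t_def[of k] abs_d_Suc[of k] real_norm_def distrib_right by linarith
  show ?thesis
  proof (rule that[of "\<lambda>k. - t k / d k"]; intro allI)
    show "- t k / d k = \<theta> k * (\<tau> (Suc k) - - t (Suc k) / d (Suc k))" for k
      unfolding t_step[of k] using d_nonzero[of k] \<theta>_bounds(1)[of k]
      by (simp add: d.simps(2) field_simps)
    show "\<bar>- t k / d k\<bar> \<le> 1 + \<theta> k" for k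
      using t_le[of k] d_nonzero[of k] by (simp add: abs_divide divide_le_eq)
  qed
qed

lemma digit_sequence_exists:
  assumes "\<And>k. \<bar>\<tau> k\<bar> \<le> 1" "\<And>k. even (a (Suc k) + \<tau> (Suc k))"
  obtains \<gamma> S T where "digit_sequence \<alpha> a 0 \<tau> S T" "cell \<gamma> 0 (S 0) (T 0)"
    "\<forall>k. \<bar>S k\<bar> \<le> 2" "\<forall>k. \<bar>T k\<bar> \<le> 2"
proof -
  obtain S :: "nat \<Rightarrow> real" where S: "S 0 = 1" "\<forall>k. S (Suc k) = \<phi> (Suc k) * (\<tau> (Suc k) + S k)"
    "\<forall>k. \<bar>S k\<bar> \<le> 1 + \<phi> k"
    by (rule forward_digits_exist[of \<tau>, OF assms(1)])
  obtain T :: "nat \<Rightarrow> real" where T: "\<forall>k. T k = \<theta> k * (\<tau> (Suc k) - T (Suc k))"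
    "\<forall>k. \<bar>T k\<bar> \<le> 1 + \<theta> k"
    by (rule backward_digits_exist[of \<tau>, OF assms(1)])
  define \<gamma> where "\<gamma> = \<alpha> + (1 - \<theta> 0 + T 0) / 2"
  show ?thesis
  proof (rule that)
    show "digit_sequence \<alpha> a 0 \<tau> S T"
      by unfold_locales (rule S(2)[rule_format] T(1)[rule_format] assms(2))+
    have "coord_X 0 1 = 1 + \<phi> 0 + S 0" unfolding coord_X_def \<phi>_def S(1) by simp
    moreover have "coord_Y \<gamma> 0 1 0 = 1 - \<theta> 0 + T 0" unfolding coord_Y_def \<gamma>_def by simp
    ultimately show "cell \<gamma> 0 (S 0) (T 0)" unfolding cell_def by blast
    show "\<forall>k. \<bar>S k\<bar> \<le> 2" using S(3) add_left_mono[OF \<phi>_le_1, of 1] by (fastforce intro: order_trans)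
    show "\<forall>k. \<bar>T k\<bar> \<le> 2"
      using T(2) add_left_mono[OF less_imp_le[OF \<theta>_bounds(2)], of 1]
      by (fastforce intro: order_trans)
  qed
qed

end

section \<open>Lower bounds from small digit sequences\<close>

lemma concave_quadratic_ge:
  fixes b c u w p q t :: real
  assumes "0 \<le> c" "p \<le> t" "t \<le> q" "b \<le> (p + u) * (w - c * p)" "b \<le> (q + u) * (w - c * q)"
  shows "b \<le> (t + u) * (w - c * t)"
proof (cases "p = q")
  case False
  have "(q - p) * b = (q - t) * b + (t - p) * b" by algebra
  also have "\<dots> \<le> (q - t) * ((p + u) * (w - c * p)) + (t - p) * ((q + u) * (w - c * q))"
    using assms by (intro add_mono mult_left_mono) auto
  also have "\<dots> = (q - p) * ((t + u) * (w - c * t)) - c * ((t - p) * (q - t) * (q - p))" by algebra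
  also have "\<dots> \<le> (q - p) * ((t + u) * (w - c * t))" using assms by simp
  finally show ?thesis using False assms by simp
qed (use assms in auto)

lemma line_product_ge:
  fixes b c e t u w :: real
  assumes "0 < c" "0 < w" "\<bar>u\<bar> < 1" "0 \<le> e" "c * (e - 1) \<le> w" "w \<le> c * (e + 1)"
    and vertex: "\<And>p. p \<in> {-1, 1, e - 1, e + 1} \<Longrightarrow> b \<le> \<bar>p + u\<bar> * \<bar>w - c * p\<bar>"
    and t: "t \<le> -1 \<or> 1 \<le> t \<and> t \<le> e - 1 \<or> 1 \<le> t \<and> e + 1 \<le> t"
  shows "b \<le> \<bar>t + u\<bar> * \<bar>w - c * t\<bar>"
proof -
  consider "t \<le> -1" | "1 \<le> t" "t \<le> e - 1" | "1 \<le> t" "e + 1 \<le> t" using t by blast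
  then show ?thesis
  proof cases
    case 1
    have "c * t \<le> c * (-1)" using 1 \<open>0 < c\<close> by (intro mult_left_mono) auto
    then have "\<bar>-1 + u\<bar> * \<bar>w - c * (-1)\<bar> \<le> \<bar>t + u\<bar> * \<bar>w - c * t\<bar>"
      using 1 assms(1-3) by (intro mult_mono) linarith+
    then show ?thesis using vertex[of "-1"] by simp
  next
    case 2
    have pos: "\<bar>p + u\<bar> * \<bar>w - c * p\<bar> = (p + u) * (w - c * p)" if "1 \<le> p" "p \<le> e - 1" for p
    proof -
      have "c * p \<le> c * (e - 1)" using that \<open>0 < c\<close> by (intro mult_left_mono) auto
      then show ?thesis using that assms(3,5) by simp
    qed
    have "b \<le> (t + u) * (w - c * t)"
      using 2 \<open>0 < c\<close> vertex[of 1] vertex[of "e - 1"] pos[of 1] pos[of "e - 1"]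
      by (intro concave_quadratic_ge[of c 1 t "e - 1"]) auto
    then show ?thesis using pos[OF 2] by simp
  next
    case 3
    have "c * (e + 1) \<le> c * t" using 3 \<open>0 < c\<close> by (intro mult_left_mono) auto
    then have "\<bar>(e + 1) + u\<bar> * \<bar>w - c * (e + 1)\<bar> \<le> \<bar>t + u\<bar> * \<bar>w - c * t\<bar>"
      using 3 assms(3,4,6) by (intro mult_mono) linarith+
    then show ?thesis using vertex[of "e + 1"] by simp
  qed
qed

locale small_digit_sequence = digit_sequence +
  fixes B :: real
  assumes B_le_1: "B \<le> 1"
    and vertices: "M \<le> k \<Longrightarrow> vertices_ge B (\<phi> k) (\<theta> k) (S k) (T k)"
    and S_small: "M \<le> k \<Longrightarrow> \<bar>S k\<bar> \<le> 1 / 10" and T_small: "M \<le> k \<Longrightarrow> \<bar>T k\<bar> \<le> 1 / 10"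
    and \<phi>_small: "M \<le> k \<Longrightarrow> \<phi> k \<le> 1 / 10" and \<theta>_small: "M \<le> k \<Longrightarrow> \<theta> k \<le> 1 / 10"
begin

lemma small_digit_sequence_uminus:
  "small_digit_sequence \<alpha> a M (\<lambda>k. - \<tau> k) (\<lambda>k. - S k) (\<lambda>k. - T k) B"
proof unfold_locales
  fix k assume k: "M \<le> k"
  show "- S (Suc k) = \<phi> (Suc k) * (real_of_int (- \<tau> (Suc k)) + - S k)"
    unfolding S_Suc[OF k] by (simp add: algebra_simps)
  show "- T k = \<theta> k * (real_of_int (- \<tau> (Suc k)) - - T (Suc k))"
    unfolding T_eq[OF k] by (simp add: algebra_simps)
qed (use parity B_le_1 vertices S_small T_small \<phi>_small \<theta>_small in \<open>auto simp: vertices_ge_uminus\<close>)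

lemma \<phi>_\<theta>_le: "M \<le> k \<Longrightarrow> \<phi> k * \<theta> k \<le> 1 / 100"
  using mult_mono[OF \<phi>_small \<theta>_small, of k k] \<theta>_bounds(1)[of k] by simp

lemma line_vertex_ge:
  fixes p :: real
  assumes "M \<le> k" "p \<in> {-1, 1, real_of_int (a (Suc k)) + \<tau> (Suc k) - 1,
      real_of_int (a (Suc k)) + \<tau> (Suc k) + 1}"
  shows "B \<le> cell_product (\<phi> k) (\<theta> k) (S k) (T k) p 1"
proof -
  consider "p \<in> {1, -1}" | t :: real where "t \<in> {1, -1}"
    "p = real_of_int (a (Suc k)) * 1 + t + \<tau> (Suc k)"
    using assms(2) by (auto intro: that(2)[of 1] that(2)[of "-1"])
  then show ?thesis
  proof cases
    case 1
    then show ?thesis using vertices[OF assms(1)] unfolding vertices_ge_def by blast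
  next
    case 2
    have "vertices_ge B (\<phi> (Suc k)) (\<theta> (Suc k)) (S (Suc k)) (T (Suc k))"
      using assms(1) by (intro vertices) simp
    then show ?thesis
      unfolding 2(2) cell_product_Suc[OF S_Suc[OF assms(1)] T_eq[OF assms(1)]] vertices_ge_def
      using 2(1) by blast
  qed
qed

lemma line_sign_change:
  assumes "M \<le> k"
  shows "\<theta> k * (real_of_int (a (Suc k)) + \<tau> (Suc k) - 1) \<le> 1 + T k"
    "1 + T k \<le> \<theta> k * (real_of_int (a (Suc k)) + \<tau> (Suc k) + 1)"
proof -
  note Y = cell_coords_Suc(2)[OF S_Suc[OF assms] T_eq[OF assms], of 1]
  have "0 \<le> \<theta> k * (1 + \<theta> (Suc k) - T (Suc k))" "0 \<le> \<theta> k * (1 - \<theta> (Suc k) + T (Suc k))"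
    using assms \<theta>_bounds(1)[of k] \<theta>_bounds(1)[of "Suc k"] \<theta>_small[of "Suc k"] T_small[of "Suc k"]
    by (auto intro!: mult_nonneg_nonneg)
  with Y[of "-1"] Y[of 1]
  show "\<theta> k * (real_of_int (a (Suc k)) + \<tau> (Suc k) - 1) \<le> 1 + T k"
    "1 + T k \<le> \<theta> k * (real_of_int (a (Suc k)) + \<tau> (Suc k) + 1)"
    by (simp_all add: algebra_simps)
qed

lemma cell_product_line_ge:
  fixes I :: int
  assumes "M \<le> k" "odd I"
  shows "B \<le> cell_product (\<phi> k) (\<theta> k) (S k) (T k) I 1"
proof -
  define e where "e = a (Suc k) + \<tau> (Suc k)"
  have product_iff: "B \<le> cell_product (\<phi> k) (\<theta> k) (S k) (T k) p 1 \<longleftrightarrow>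
      B * (1 + \<phi> k * \<theta> k) \<le> \<bar>p + (\<phi> k + S k)\<bar> * \<bar>(1 + T k) - \<theta> k * p\<bar>" for p :: real
  proof -
    have "p + 1 * \<phi> k + S k = p + (\<phi> k + S k)" "1 - p * \<theta> k + T k = (1 + T k) - \<theta> k * p" by simp_all
    moreover have "0 < 1 + \<phi> k * \<theta> k" using \<phi>_\<theta>_nonneg[of k] by simp
    ultimately show ?thesis unfolding cell_product_def by (simp only: pos_le_divide_eq)
  qed
  have e_real: "real_of_int (a (Suc k)) + \<tau> (Suc k) = e" unfolding e_def by simp
  note sign = line_sign_change[OF assms(1), unfolded e_real]
  have "0 < \<theta> k * (real_of_int e + 1)" using sign(2) T_small[OF assms(1)] by linarith
  then have "0 < real_of_int e + 1" using \<theta>_bounds(1)[of k] by (simp add: zero_less_mult_iff)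
  then have "0 \<le> e" by simp
  have "even e" using parity[OF assms(1)] unfolding e_def .
  then have "I \<le> -1 \<or> 1 \<le> I \<and> I \<le> e - 1 \<or> 1 \<le> I \<and> e + 1 \<le> I" using assms(2) by presburger
  then have I: "real_of_int I \<le> -1 \<or> 1 \<le> real_of_int I \<and> I \<le> real_of_int e - 1 \<or>
      1 \<le> real_of_int I \<and> real_of_int e + 1 \<le> I" by linarith
  show ?thesis unfolding product_iff
  proof (rule line_product_ge[OF \<theta>_bounds(1) _ _ _ sign _ I])
    show "0 < 1 + T k" using T_small[OF assms(1)] by linarith
    show "\<bar>\<phi> k + S k\<bar> < 1"
      using S_small[OF assms(1)] \<phi>_small[OF assms(1)] \<phi>_nonneg[of k] by linarith
  qed (use \<open>0 \<le> e\<close> line_vertex_ge[OF assms(1), unfolded product_iff e_real] in auto)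
qed

lemma cell_product_far_ge:
  assumes "M \<le> k" "3 \<le> \<bar>J\<bar>" and X: "X = I + J * \<phi> k + S k" "9 / 10 \<le> \<bar>X\<bar>" "\<phi> (Suc k) * \<bar>X\<bar> < 9 / 10"
  shows "B \<le> cell_product (\<phi> k) (\<theta> k) (S k) (T k) I J"
proof -
  define Y where "Y = J - I * \<theta> k + T k"
  note pos = \<phi>_nonneg[of k] \<theta>_bounds(1)[of k] \<phi>_Suc_pos[of k]
  have "\<theta> k = \<phi> (Suc k) * (a (Suc k) * \<theta> k + \<phi> k * \<theta> k)"
    using arg_cong[OF \<phi>_step[of k], of "\<lambda>r. r * \<theta> k"] by (simp add: algebra_simps)
  also have "\<dots> \<le> \<phi> (Suc k) * (1 + 1 / 100)"
  proof (intro mult_left_mono add_mono)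
    have "a (Suc k) * \<theta> k + \<theta> k * \<theta> (Suc k) = 1" using \<theta>_step[of k] by (simp add: algebra_simps)
    then show "a (Suc k) * \<theta> k \<le> 1"
      using pos \<theta>_bounds(1)[of "Suc k"] mult_nonneg_nonneg[of "\<theta> k" "\<theta> (Suc k)"] by linarith
  qed (use \<phi>_\<theta>_le[OF assms(1)] pos in auto)
  finally have "\<theta> k * \<bar>X\<bar> \<le> \<phi> (Suc k) * (1 + 1 / 100) * \<bar>X\<bar>" by (intro mult_right_mono) auto
  then have "\<bar>X * \<theta> k\<bar> \<le> 1" using X(3) pos by (simp add: abs_mult mult_ac)
  moreover have "\<bar>J * (\<phi> k * \<theta> k)\<bar> \<le> \<bar>J\<bar> * (1 / 100)"
    unfolding abs_mult[of J] using \<phi>_\<theta>_nonneg[of k] \<phi>_\<theta>_le[OF assms(1)]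
    by (intro mult_left_mono) auto
  moreover have "\<bar>S k * \<theta> k\<bar> \<le> 1 / 10 * (1 / 10)"
    unfolding abs_mult using S_small[OF assms(1)] \<theta>_small[OF assms(1)] pos by (intro mult_mono) auto
  moreover have "Y = J - X * \<theta> k + J * (\<phi> k * \<theta> k) + S k * \<theta> k + T k"
    unfolding X(1) Y_def by (simp add: algebra_simps)
  ultimately have "6 / 5 \<le> \<bar>Y\<bar>" using assms(2) T_small[OF assms(1)] by linarith
  have "B * (1 + \<phi> k * \<theta> k) \<le> 1 * (1 + \<phi> k * \<theta> k)"
    using B_le_1 \<phi>_\<theta>_nonneg[of k] by (intro mult_right_mono) auto
  also have "\<dots> \<le> 9 / 10 * (6 / 5)" using \<phi>_\<theta>_le[OF assms(1)] by simp
  also have "\<dots> \<le> \<bar>X\<bar> * \<bar>Y\<bar>" using X(2) \<open>6 / 5 \<le> \<bar>Y\<bar>\<close> by (intro mult_mono) auto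
  finally show ?thesis
    unfolding cell_product_def X(1) Y_def using \<phi>_\<theta>_nonneg[of k] by (simp add: pos_le_divide_eq)
qed

lemma cell_product_ge:
  fixes I J :: int
  assumes "M \<le> k" "odd I" "odd J" "X = I + J * \<phi> k + S k" "9 / 10 \<le> \<bar>X\<bar>" "\<phi> (Suc k) * \<bar>X\<bar> < 9 / 10"
  shows "B \<le> cell_product (\<phi> k) (\<theta> k) (S k) (T k) I J"
proof -
  have "J = 1 \<or> J = -1 \<or> 3 \<le> \<bar>J\<bar>" using assms(3) by presburger
  then consider "J = 1" | "J = -1" | "3 \<le> \<bar>J\<bar>" by blast
  then show ?thesis
  proof cases
    case 1
    then show ?thesis using cell_product_line_ge[OF assms(1,2)] by simp
  next
    case 2
    have "B \<le> cell_product (\<phi> k) (\<theta> k) (- S k) (- T k) (real_of_int (- I)) 1"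
      using small_digit_sequence.cell_product_line_ge[OF small_digit_sequence_uminus assms(1), of "- I"] assms(2)
      by simp
    then show ?thesis using cell_product_uminus[of "\<phi> k" "\<theta> k" "S k" "T k" I "-1"] 2 by simp
  next
    case 3
    then have "3 \<le> \<bar>real_of_int J\<bar>" by linarith
    then show ?thesis using cell_product_far_ge[OF assms(1) _ assms(4-6)] by blast
  qed
qed

lemma coord_X_level:
  assumes "Q (Suc M) \<le> \<bar>n\<bar>"
  obtains k where "M \<le> k" "9 / 10 \<le> \<bar>coord_X k n\<bar>" "\<bar>coord_X (Suc k) n\<bar> < 9 / 10"
proof -
  define P where "P i \<longleftrightarrow> \<bar>coord_X (M + i) n\<bar> < 9 / 10" for i
  have abs_coord_X: "\<bar>coord_X k n\<bar> = 2 * \<bar>n\<bar> / Q (Suc k)" for k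
    unfolding coord_X_def using Q_Suc_pos[of k] by (simp add: abs_mult)
  have "\<not> P 0"
    unfolding P_def abs_coord_X using assms Q_Suc_pos[of M] by (simp add: not_less le_divide_eq)
  moreover obtain K where "\<forall>k\<ge>K. 20 / 9 * \<bar>real_of_int n\<bar> < Q (Suc k)"
    using eventually_Q_gt unfolding eventually_sequentially by blast
  then have "20 / 9 * \<bar>real_of_int n\<bar> < Q (Suc (M + K))" by simp
  then have "P K"
    unfolding P_def abs_coord_X using Q_Suc_pos[of "M + K"] by (simp add: divide_less_eq)
  ultimately obtain i where "\<forall>j\<le>i. \<not> P j" "P (Suc i)" using ex_least_nat_less[of P K] by blast
  then show ?thesis using that[of "M + i"] unfolding P_def by force
qed

lemma shift_not_in_int_span:
  assumes "cell \<gamma> M (S M) (T M)"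
  shows "\<gamma> \<notin> int_span \<alpha>"
proof
  assume "\<gamma> \<in> int_span \<alpha>"
  then obtain m n :: int where \<gamma>: "\<gamma> = m + n * \<alpha>" by blast
  obtain k where k: "M \<le> k" "4 * \<bar>real_of_int n\<bar> < Q (Suc k)"
    using eventually_Q_gt unfolding eventually_sequentially by (meson nat_le_linear)
  obtain I J :: int where "odd I" and X: "coord_X k n = I + J * \<phi> k + S k"
    and Y: "coord_Y \<gamma> k n (- m) = J - I * \<theta> k + T k"
    by (rule cell_coords[OF cell_at[OF assms k(1)]])
  have "coord_Y \<gamma> k n (- m) = 0" unfolding coord_Y_def \<gamma> by simp
  then have J: "real_of_int J = I * \<theta> k - T k" using Y by simp
  have "coord_X k n = I * (1 + \<phi> k * \<theta> k) + (S k - T k * \<phi> k)"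
    unfolding X J by (simp add: algebra_simps)
  moreover have "1 * 1 \<le> \<bar>I * (1 + \<phi> k * \<theta> k)\<bar>"
  proof -
    have "1 \<le> \<bar>I\<bar>" using \<open>odd I\<close> by presburger
    then have "1 \<le> \<bar>real_of_int I\<bar>" by linarith
    then show ?thesis unfolding abs_mult using \<phi>_\<theta>_nonneg[of k] by (intro mult_mono) auto
  qed
  moreover have "\<bar>T k * \<phi> k\<bar> \<le> 1 / 10 * 1"
    unfolding abs_mult using T_small[OF k(1)] \<phi>_nonneg[of k] \<phi>_le_1[of k] by (intro mult_mono) auto
  ultimately have "1 / 2 \<le> \<bar>coord_X k n\<bar>" using S_small[OF k(1)] by linarith
  moreover have "\<bar>coord_X k n\<bar> < 1 / 2"
    unfolding coord_X_def using k(2) Q_Suc_pos[of k] by (simp add: abs_mult divide_less_eq)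
  ultimately show False by linarith
qed

lemma approx_const_ge:
  assumes "cell \<gamma> M (S M) (T M)"
  shows "ereal (B / 4) \<le> approx_const \<alpha> \<gamma>"
proof (rule approx_const_geI)
  fix n m :: int assume "Q (Suc M) \<le> \<bar>n\<bar>"
  then obtain k where k: "M \<le> k" "9 / 10 \<le> \<bar>coord_X k n\<bar>" "\<bar>coord_X (Suc k) n\<bar> < 9 / 10"
    by (rule coord_X_level)
  obtain I J :: int where IJ: "odd I" "odd J"
    "coord_X k n = I + J * \<phi> k + S k" "coord_Y \<gamma> k n m = J - I * \<theta> k + T k"
    by (rule cell_coords[OF cell_at[OF assms k(1)]])
  have "\<phi> (Suc k) * \<bar>coord_X k n\<bar> < 9 / 10"
    using k(3) \<phi>_nonneg[of "Suc k"] by (simp add: coord_X_Suc abs_mult)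
  then have "B \<le> cell_product (\<phi> k) (\<theta> k) (S k) (T k) I J"
    using cell_product_ge[OF k(1) IJ(1,2,3) k(2)] by blast
  then show "B / 4 \<le> \<bar>real_of_int n\<bar> * \<bar>n * \<alpha> - m - \<gamma>\<bar>" using grid_product[OF IJ(3,4)] by simp
qed

lemma rho_ge: "cell \<gamma> M (S M) (T M) \<Longrightarrow> ereal (B / 4) \<le> rho \<alpha>"
  by (rule order_trans[OF approx_const_ge approx_const_le_rho[OF shift_not_in_int_span]])

end

section \<open>Estimates for vertices and digit steps\<close>

lemma small_powers:
  fixes x :: real
  assumes "0 < x" "x \<le> 1 / 1000"
  shows "0 < x ^ 2" "x ^ 2 \<le> x / 1000" "0 < x ^ 3" "x ^ 3 \<le> x ^ 2 / 1000"
    "0 < x ^ 4" "x ^ 4 \<le> x ^ 3 / 1000" "0 < x ^ 5" "x ^ 5 \<le> x ^ 4 / 1000"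
    "0 < x ^ 6" "x ^ 6 \<le> x ^ 5 / 1000" "0 < x ^ 7" "x ^ 7 \<le> x ^ 6 / 1000"
proof -
  have "x ^ Suc k \<le> x ^ k / 1000" for k
    using assms mult_right_mono[of x "1/1000" "x ^ k"] by simp
  from this[of 1] this[of 2] this[of 3] this[of 4] this[of 5] this[of 6]
  show "x ^ 2 \<le> x / 1000" "x ^ 3 \<le> x ^ 2 / 1000" "x ^ 4 \<le> x ^ 3 / 1000" "x ^ 5 \<le> x ^ 4 / 1000"
    "x ^ 6 \<le> x ^ 5 / 1000" "x ^ 7 \<le> x ^ 6 / 1000" by (simp_all add: numeral_eq_Suc)
qed (use assms in auto)

text \<open>These bound \<open>4\<rho>\<close>; the cubic coefficients are not optimal.\<close>

abbreviation lower_poly :: "real \<Rightarrow> real" where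
  "lower_poly x \<equiv> 1 - 2 * x - 2 * x\<^sup>2 - 20 * x ^ 3"

abbreviation upper_poly :: "real \<Rightarrow> real" where
  "upper_poly x \<equiv> 1 - 2 * x - 2 * x\<^sup>2 + 80 * x ^ 3"

lemma vertices_ge_iff:
  assumes "0 \<le> \<phi>" "0 \<le> \<theta>" "\<phi> + \<bar>S\<bar> \<le> 1" "\<theta> + \<bar>T\<bar> \<le> 1"
  shows "vertices_ge b \<phi> \<theta> S T \<longleftrightarrow> (\<forall>s\<in>{1, -1}. \<forall>t\<in>{1, -1}.
    b * (1 + \<phi> * \<theta>) \<le> (1 + s * t * \<phi> + s * S) * (1 - s * t * \<theta> + t * T))"
proof -
  have "b \<le> cell_product \<phi> \<theta> S T s t \<longleftrightarrow>
      b * (1 + \<phi> * \<theta>) \<le> (1 + s * t * \<phi> + s * S) * (1 - s * t * \<theta> + t * T)"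
    if "s \<in> {1, -1}" "t \<in> {1, -1}" for s t :: real
  proof -
    have "\<bar>s + t * \<phi> + S\<bar> = 1 + s * t * \<phi> + s * S" "\<bar>t - s * \<theta> + T\<bar> = 1 - s * t * \<theta> + t * T"
      using that assms by auto
    moreover have "0 < 1 + \<phi> * \<theta>" using assms(1,2) by (simp add: add_pos_nonneg)
    ultimately show ?thesis unfolding cell_product_def by (simp only: pos_le_divide_eq)
  qed
  then show ?thesis unfolding vertices_ge_def by simp
qed

lemma vertices_ge_imp_small_center:
  fixes b \<epsilon> \<phi> \<theta> \<xi> \<eta> :: real
  assumes pt: "0 \<le> \<phi>" "\<phi> \<le> \<epsilon>" "0 \<le> \<theta>" "\<theta> \<le> \<epsilon>" and \<epsilon>: "\<epsilon> \<le> 1" and \<xi>\<eta>: "\<bar>\<xi>\<bar> \<le> 1" "\<bar>\<eta>\<bar> \<le> 1"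
    and vertices: "vertices_ge b \<phi> \<theta> (\<xi> + \<eta> * \<phi>) (\<eta> - \<xi> * \<theta>)"
  shows "\<bar>\<xi>\<bar> \<le> 1 - b + 12 * \<epsilon>" "\<bar>\<eta>\<bar> \<le> 1 - b + 12 * \<epsilon>"
proof -
  have product: "b - 12 * \<epsilon> \<le> (1 + s * \<xi>) * (1 + t * \<eta>)" if st: "s \<in> {1, -1}" "t \<in> {1, -1}" for s t
  proof -
    define A B where "A = s + \<xi>" and "B = t + \<eta>"
    have AB: "\<bar>A\<bar> = 1 + s * \<xi>" "\<bar>B\<bar> = 1 + t * \<eta>" "\<bar>A\<bar> \<le> 2" "\<bar>B\<bar> \<le> 2"
      using st \<xi>\<eta> unfolding A_def B_def by auto
    have "s + t * \<phi> + (\<xi> + \<eta> * \<phi>) = A + B * \<phi>" "t - s * \<theta> + (\<eta> - \<xi> * \<theta>) = B - A * \<theta>"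
      unfolding A_def B_def by (simp_all add: algebra_simps)
    then have "b \<le> \<bar>A + B * \<phi>\<bar> * \<bar>B - A * \<theta>\<bar> / (1 + \<phi> * \<theta>)"
      using vertices st unfolding vertices_ge_def cell_product_def by metis
    also have "\<dots> \<le> \<bar>A + B * \<phi>\<bar> * \<bar>B - A * \<theta>\<bar> / 1"
      using pt by (intro divide_left_mono) (auto simp: add_pos_nonneg)
    also have "\<dots> \<le> (\<bar>A\<bar> + \<bar>B\<bar> * \<phi>) * (\<bar>B\<bar> + \<bar>A\<bar> * \<theta>)"
      unfolding div_by_1 using pt abs_triangle_ineq[of A "B * \<phi>"] abs_triangle_ineq4[of B "A * \<theta>"]
      by (intro mult_mono) (auto simp: abs_mult)
    also have "\<dots> = \<bar>A\<bar> * \<bar>B\<bar> + \<bar>A\<bar> * \<bar>A\<bar> * \<theta> + \<bar>B\<bar> * \<bar>B\<bar> * \<phi> + \<bar>A\<bar> * \<bar>B\<bar> * (\<phi> * \<theta>)" by algebra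
    also have "\<dots> \<le> \<bar>A\<bar> * \<bar>B\<bar> + 2 * 2 * \<epsilon> + 2 * 2 * \<epsilon> + 2 * 2 * (\<epsilon> * 1)"
      using AB(3,4) pt \<epsilon> by (intro add_mono mult_mono order_refl) auto
    finally show ?thesis unfolding AB by simp
  qed
  have "2 * (b - 12 * \<epsilon>) \<le> 2 * (1 + s * \<xi>)" "2 * (b - 12 * \<epsilon>) \<le> 2 * (1 + s * \<eta>)" if "s \<in> {1, -1}" for s
    using product[OF that, of 1] product[OF that, of "-1"] product[OF _ that, of 1]
      product[OF _ that, of "-1"]
    by (simp_all add: algebra_simps)
  from this[of 1] this[of "-1"] show "\<bar>\<xi>\<bar> \<le> 1 - b + 12 * \<epsilon>" "\<bar>\<eta>\<bar> \<le> 1 - b + 12 * \<epsilon>" by auto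
qed

lemma vertex_product_first_order:
  fixes x \<phi> \<theta> S T s t :: real
  assumes x: "0 < x" "x \<le> 1 / 1000" and near: "\<bar>\<phi> - x\<bar> \<le> 3 * x\<^sup>2" "\<bar>\<theta> - x\<bar> \<le> 3 * x\<^sup>2"
    and ST: "\<bar>S\<bar> \<le> 20 * x" "\<bar>T\<bar> \<le> 20 * x" and st: "s \<in> {1, -1}" "t \<in> {1, -1}"
  shows "\<bar>(1 + s * t * \<phi> + s * S) * (1 - s * t * \<theta> + t * T) - (1 + s * S + t * T)\<bar> \<le> 450 * x\<^sup>2"
proof -
  note powers = small_powers[OF x]
  define A B where "A = s * t * \<phi> + s * S" and "B = t * T - s * t * \<theta>"
  have "\<bar>\<phi>\<bar> \<le> 101 / 100 * x" "\<bar>\<theta>\<bar> \<le> 101 / 100 * x" using near x powers by linarith+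
  moreover have "\<bar>A\<bar> \<le> \<bar>\<phi>\<bar> + \<bar>S\<bar>" "\<bar>B\<bar> \<le> \<bar>\<theta>\<bar> + \<bar>T\<bar>" using st unfolding A_def B_def by auto
  ultimately have "\<bar>A\<bar> \<le> 2101 / 100 * x" "\<bar>B\<bar> \<le> 2101 / 100 * x" using ST by linarith+
  then have "\<bar>A\<bar> * \<bar>B\<bar> \<le> (2101 / 100 * x) * (2101 / 100 * x)" using x by (intro mult_mono) auto
  then have "\<bar>A * B\<bar> \<le> 442 * x\<^sup>2" using powers(1) by (simp add: abs_mult power2_eq_square)
  moreover have "\<bar>s * t * (\<phi> - \<theta>)\<bar> \<le> 6 * x\<^sup>2" using near st by auto
  moreover have "(1 + s * t * \<phi> + s * S) * (1 - s * t * \<theta> + t * T) - (1 + s * S + t * T) =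
      A * B + s * t * (\<phi> - \<theta>)" unfolding A_def B_def by algebra
  ultimately show ?thesis by linarith
qed

lemma vertices_ge_imp_sum_le:
  fixes x \<phi> \<theta> S T b :: real
  assumes x: "0 < x" "x \<le> 1 / 1000" and near: "\<bar>\<phi> - x\<bar> \<le> 3 * x\<^sup>2" "\<bar>\<theta> - x\<bar> \<le> 3 * x\<^sup>2"
    and ST: "\<bar>S\<bar> \<le> 20 * x" "\<bar>T\<bar> \<le> 20 * x"
    and b: "1 - 2 * x - 2 * x\<^sup>2 \<le> b" and vertices: "vertices_ge b \<phi> \<theta> S T"
  shows "\<bar>S\<bar> + \<bar>T\<bar> \<le> 2 * x + 452 * x\<^sup>2"
proof -
  have pos: "0 \<le> \<phi>" "0 \<le> \<theta>" "\<phi> + \<bar>S\<bar> \<le> 1" "\<theta> + \<bar>T\<bar> \<le> 1"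
    using near ST x small_powers(2)[OF x] by linarith+
  have "b * 1 \<le> b * (1 + \<phi> * \<theta>)"
    using pos b x small_powers(2)[OF x] by (intro mult_left_mono) auto
  then have "- 2 * x - 452 * x\<^sup>2 \<le> s * S + t * T" if "s \<in> {1, -1}" "t \<in> {1, -1}" for s t
    using vertices[unfolded vertices_ge_iff[OF pos], rule_format, OF that]
      vertex_product_first_order[OF x near ST that] b by linarith
  from this[of 1 1] this[of 1 "-1"] this[of "-1" 1] this[of "-1" "-1"] show ?thesis by auto
qed

lemma loose_vertex_ge:
  fixes x \<phi> \<theta> S T s t :: real
  assumes x: "0 < x" "x \<le> 1 / 1000" and near: "\<bar>\<phi> - x\<bar> \<le> 3 * x\<^sup>2" "\<bar>\<theta> - x\<bar> \<le> 3 * x\<^sup>2"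
    and ST: "\<bar>S\<bar> \<le> 20 * x" "\<bar>T\<bar> \<le> 20 * x" and st: "s \<in> {1, -1}" "t \<in> {1, -1}"
    and loose: "- (3 / 2) * x \<le> s * S + t * T"
  shows "lower_poly x * (1 + \<phi> * \<theta>)
    \<le> (1 + s * t * \<phi> + s * S) * (1 - s * t * \<theta> + t * T)"
proof -
  note powers = small_powers[OF x]
  have "\<phi> * \<theta> \<le> (101 / 100 * x) * (101 / 100 * x)"
    using near x powers by (intro mult_mono) linarith+
  then have "\<phi> * \<theta> \<le> 2 * x\<^sup>2" using powers(1) by (simp add: power2_eq_square)
  then have "lower_poly x * (1 + \<phi> * \<theta>) \<le> lower_poly x * (1 + 2 * x\<^sup>2)"
    using x powers by (intro mult_left_mono) linarith+
  also have "\<dots> = 1 - 2 * x - 24 * x ^ 3 - 4 * x ^ 4 - 40 * x ^ 5" by algebra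
  also have "\<dots> \<le> 1 + s * S + t * T - 450 * x\<^sup>2" using loose powers by linarith
  finally show ?thesis using vertex_product_first_order[OF x near ST st] by linarith
qed

lemma tight_vertex_ge:
  fixes x \<phi> \<theta> S T :: real
  assumes x: "0 < x" "x \<le> 1 / 1000" and close: "x - 2 * x ^ 3 \<le> \<phi>" "\<phi> \<le> x" "0 \<le> \<theta>" "\<theta> \<le> x"
    and S: "S \<le> x + x\<^sup>2 + 6 * x ^ 3" and T: "T \<le> x + 3 * x ^ 3"
  shows "lower_poly x * (1 + \<phi> * \<theta>) \<le> (1 + \<phi> - S) * (1 - \<theta> - T)"
proof -
  note powers = small_powers[OF x]
  have "\<phi> * \<theta> \<le> x * x" using close x powers by (intro mult_mono) auto
  then have "lower_poly x * (1 + \<phi> * \<theta>) \<le> lower_poly x * (1 + x\<^sup>2)"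
    using x powers by (intro mult_left_mono) (auto simp: power2_eq_square[symmetric])
  also have "\<dots> = 1 - 2 * x - x ^ 2 - 22 * x ^ 3 - 2 * x ^ 4 - 20 * x ^ 5" by algebra
  also have "\<dots> \<le> 1 - 2 * x - x ^ 2 - 9 * x ^ 3 + 16 * x ^ 4 + 3 * x ^ 5 + 24 * x ^ 6"
    using powers by linarith
  also have "\<dots> = (1 - x\<^sup>2 - 8 * x ^ 3) * (1 - 2 * x - 3 * x ^ 3)" by algebra
  also have "\<dots> \<le> (1 + \<phi> - S) * (1 - \<theta> - T)"
    using close S T x powers by (intro mult_mono) linarith+
  finally show ?thesis .
qed

lemma vertices_ge_if_loose_or_tight:
  fixes x \<phi> \<theta> S T :: real
  assumes x: "0 < x" "x \<le> 1 / 1000" and near: "\<bar>\<phi> - x\<bar> \<le> 3 * x\<^sup>2" "\<bar>\<theta> - x\<bar> \<le> 3 * x\<^sup>2"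
    and S: "- 3 * x\<^sup>2 \<le> S" "S \<le> x + 6 * x\<^sup>2" and T: "- 3 * x\<^sup>2 \<le> T" "T \<le> x + 6 * x\<^sup>2"
    and tight: "S \<le> 3 * x\<^sup>2 \<or> T \<le> 3 * x\<^sup>2 \<or>
      x - 2 * x ^ 3 \<le> \<phi> \<and> \<phi> \<le> x \<and> \<theta> \<le> x \<and> S \<le> x + x\<^sup>2 + 6 * x ^ 3 \<and> T \<le> x + 3 * x ^ 3"
  shows "vertices_ge (lower_poly x) \<phi> \<theta> S T"
proof -
  note powers = small_powers[OF x]
  have pos: "0 \<le> \<phi>" "0 \<le> \<theta>" "\<phi> + \<bar>S\<bar> \<le> 1" "\<theta> + \<bar>T\<bar> \<le> 1" and ST: "\<bar>S\<bar> \<le> 20 * x" "\<bar>T\<bar> \<le> 20 * x"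
    using near S T x powers by linarith+
  note loose = loose_vertex_ge[OF x near ST]
  have "lower_poly x * (1 + \<phi> * \<theta>)
      \<le> (1 + s * t * \<phi> + s * S) * (1 - s * t * \<theta> + t * T)" if "s \<in> {1, -1}" "t \<in> {1, -1}" for s t
  proof (cases "- (3 / 2) * x \<le> s * S + t * T")
    case False
    then have "s = -1" "t = -1" "3 * x\<^sup>2 < S" "3 * x\<^sup>2 < T"
      using that S T powers x by auto
    then show ?thesis using tight tight_vertex_ge[OF x _ _ pos(2)] by simp
  qed (rule loose[OF that])
  then show ?thesis unfolding vertices_ge_iff[OF pos] by blast
qed

lemma upper_poly_mult_ge:
  fixes x \<phi> \<theta> :: real
  assumes x: "0 < x" "x \<le> 1 / 1000" and close: "x - 2 * x ^ 3 \<le> \<phi>" "x - 2 * x ^ 3 \<le> \<theta>"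
  shows "1 - 2 * x - x\<^sup>2 + 77 * x ^ 3 \<le> upper_poly x * (1 + \<phi> * \<theta>)"
proof -
  note powers = small_powers[OF x]
  have "x\<^sup>2 - 4 * x ^ 4 \<le> x ^ 2 - 4 * x ^ 4 + 4 * x ^ 6" using powers by simp
  also have "\<dots> = (x - 2 * x ^ 3) * (x - 2 * x ^ 3)" by algebra
  also have "\<dots> \<le> \<phi> * \<theta>" using close powers x by (intro mult_mono) linarith+
  finally have product: "1 + (x\<^sup>2 - 4 * x ^ 4) \<le> 1 + \<phi> * \<theta>" by simp
  have "1 - 2 * x - x\<^sup>2 + 77 * x ^ 3
      \<le> 1 - 2 * x - x ^ 2 + 78 * x ^ 3 - 6 * x ^ 4 + 88 * x ^ 5 + 8 * x ^ 6 - 320 * x ^ 7"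
    using powers by linarith
  also have "\<dots> = upper_poly x * (1 + (x\<^sup>2 - 4 * x ^ 4))" by algebra
  also have "\<dots> \<le> upper_poly x * (1 + \<phi> * \<theta>)"
    by (rule mult_left_mono[OF product]) (use powers x in linarith)
  finally show ?thesis .
qed

lemma tight_vertex_less:
  fixes x p u v :: real
  assumes x: "0 < x" "x \<le> 1 / 1000" and p: "0 \<le> p" "p \<le> 1"
    and u: "u \<le> 1 - p * x\<^sup>2 + 32 * x ^ 3" and v: "0 \<le> v" "v \<le> 1 - 2 * x - (1 - p) * x\<^sup>2 + 32 * x ^ 3"
  shows "u * v < 1 - 2 * x - x\<^sup>2 + 77 * x ^ 3"
proof -
  note powers = small_powers[OF x]
  have "p * (1 - p) \<le> 1 * 1" using p by (intro mult_mono) auto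
  then have p_le: "p * x\<^sup>2 \<le> 1 * x\<^sup>2" "p * x ^ 3 \<le> 1 * x ^ 3" "p * (1 - p) * x ^ 4 \<le> 1 * x ^ 4"
    using p x by (intro mult_right_mono; simp)+
  have "u * v \<le> (1 - p * x\<^sup>2 + 32 * x ^ 3) * (1 - 2 * x - (1 - p) * x\<^sup>2 + 32 * x ^ 3)"
    using u v p_le(1) powers x by (intro mult_mono) linarith+
  also have "\<dots> = 1 - 2 * x - x ^ 2 + 64 * x ^ 3 + 2 * (p * x ^ 3) + p * (1 - p) * x ^ 4 - 64 * x ^ 4
      - 32 * x ^ 5 + 1024 * x ^ 6" by algebra
  also have "\<dots> < 1 - 2 * x - x\<^sup>2 + 77 * x ^ 3" using p_le(2,3) powers by linarith
  finally show ?thesis .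
qed

lemma not_vertices_ge_if_center_ge:
  fixes x \<phi> \<theta> S T s t p :: real
  assumes x: "0 < x" "x \<le> 1 / 1000"
    and close: "x - 2 * x ^ 3 \<le> \<phi>" "\<phi> \<le> x" "x - 2 * x ^ 3 \<le> \<theta>" "\<theta> \<le> x"
    and ST: "\<bar>S\<bar> \<le> 20 * x" "\<bar>T\<bar> \<le> 20 * x" and st: "s \<in> {1, -1}" "t \<in> {1, -1}" and p: "0 \<le> p" "p \<le> 1"
    and S: "x + p * x\<^sup>2 - 30 * x ^ 3 \<le> s * S" and T: "x + (1 - p) * x\<^sup>2 - 30 * x ^ 3 \<le> t * T"
  shows "\<not> vertices_ge (upper_poly x) \<phi> \<theta> S T"
proof
  have pos: "0 \<le> \<phi>" "0 \<le> \<theta>" "\<phi> + \<bar>S\<bar> \<le> 1" "\<theta> + \<bar>T\<bar> \<le> 1"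
    using close ST x small_powers[OF x] by linarith+
  then have factors: "0 \<le> 1 - \<phi> - s * S" "0 \<le> 1 - \<theta> - t * T" using st by auto
  assume "vertices_ge (upper_poly x) \<phi> \<theta> S T"
  then have "upper_poly x * (1 + \<phi> * \<theta>) \<le> (1 + s * t * \<phi> - s * S) * (1 - s * t * \<theta> - t * T)"
    using st unfolding vertices_ge_iff[OF pos] by auto
  with upper_poly_mult_ge[OF x close(1,3)]
  have vertex: "1 - 2 * x - x\<^sup>2 + 77 * x ^ 3 \<le> (1 + s * t * \<phi> - s * S) * (1 - s * t * \<theta> - t * T)"
    by linarith
  consider "s * t = 1" | "s * t = -1" using st by auto
  then show False
  proof cases
    case 1
    have "(1 + \<phi> - s * S) * (1 - \<theta> - t * T) < 1 - 2 * x - x\<^sup>2 + 77 * x ^ 3"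
      using S T close factors(2) by (intro tight_vertex_less[OF x p]) auto
    with vertex 1 show False by simp
  next
    case 2
    have "(1 + \<theta> - t * T) * (1 - \<phi> - s * S) < 1 - 2 * x - x\<^sup>2 + 77 * x ^ 3"
      using S T close factors(1) p by (intro tight_vertex_less[OF x, of "1 - p"]) auto
    with vertex 2 show False by (simp add: mult.commute)
  qed
qed

text \<open>
  A digit step \<open>\<psi> (\<tau> + W)\<close> is \<open>S\<^sub>k\<close> for \<open>\<psi> = \<phi>\<^sub>k\<close>, \<open>W = S\<^sub>k\<^sub>-\<^sub>1\<close>, and \<open>T\<^sub>k\<close> for \<open>\<psi> = \<theta>\<^sub>k\<close>, \<open>W = - T\<^sub>k\<^sub>+\<^sub>1\<close>.
\<close>

lemma abs_digit_step_le:
  fixes c \<psi> \<tau> W w :: real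
  assumes "0 \<le> \<psi>" "\<psi> \<le> c" "\<bar>\<tau>\<bar> \<le> 1" "\<bar>W\<bar> \<le> w"
  shows "\<bar>\<psi> * (\<tau> + W)\<bar> \<le> c * (1 + w)"
  unfolding abs_mult using assms by (intro mult_mono) auto

lemma abs_mult_near_le:
  fixes w x \<psi> W :: real
  assumes x: "0 < x" "x \<le> 1 / 1000" and near: "\<bar>\<psi> - x\<bar> \<le> 3 * x\<^sup>2" and W: "\<bar>W\<bar> \<le> w * x"
  shows "\<bar>\<psi> * W\<bar> \<le> 101 / 100 * w * x\<^sup>2"
proof -
  have "\<bar>\<psi>\<bar> \<le> 101 / 100 * x" using near small_powers(2)[OF x] x by linarith
  then have "\<bar>\<psi> * W\<bar> \<le> (101 / 100 * x) * (w * x)" unfolding abs_mult using W x by (intro mult_mono) auto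
  then show ?thesis by (simp add: power2_eq_square mult_ac)
qed

lemma abs_digit_le:
  fixes x \<psi> \<tau> W :: real
  assumes x: "0 < x" "x \<le> 1 / 1000" and near: "\<bar>\<psi> - x\<bar> \<le> 3 * x\<^sup>2" and W: "\<bar>W\<bar> \<le> 20 * x"
  shows "(x - 3 * x\<^sup>2) * \<bar>\<tau>\<bar> \<le> \<bar>\<psi> * (\<tau> + W)\<bar> + 21 * x\<^sup>2"
proof -
  note powers = small_powers[OF x]
  have "(x - 3 * x\<^sup>2) * \<bar>\<tau>\<bar> \<le> \<bar>\<psi>\<bar> * \<bar>\<tau>\<bar>" using near by (intro mult_right_mono) auto
  also have "\<dots> = \<bar>\<psi> * (\<tau> + W) - \<psi> * W\<bar>" by (simp add: abs_mult[symmetric] algebra_simps)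
  also have "\<dots> \<le> \<bar>\<psi> * (\<tau> + W)\<bar> + \<bar>\<psi> * W\<bar>" by (rule abs_triangle_ineq4)
  finally show ?thesis using abs_mult_near_le[OF x near W] powers(1) by simp
qed

lemma zero_one_digit_step:
  fixes x \<psi> \<tau> W :: real
  assumes x: "0 < x" "x \<le> 1 / 1000" and near: "\<bar>\<psi> - x\<bar> \<le> 3 * x\<^sup>2" and "\<tau> \<in> {0, 1}" and W: "\<bar>W\<bar> \<le> 2 * x"
  shows "- 3 * x\<^sup>2 \<le> \<psi> * (\<tau> + W)" "\<psi> * (\<tau> + W) \<le> x + 6 * x\<^sup>2"
    and "\<tau> = 0 \<Longrightarrow> \<psi> * (\<tau> + W) \<le> 3 * x\<^sup>2"
proof -
  note powers = small_powers[OF x]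
  have \<psi>: "0 \<le> \<psi>" "\<psi> \<le> 101 / 100 * x" using near x powers by linarith+
  have \<psi>W: "\<bar>\<psi> * W\<bar> \<le> 3 * x\<^sup>2" using abs_mult_near_le[OF x near W] powers(1) by simp
  have "0 \<le> \<psi> * \<tau>" "\<psi> * \<tau> \<le> x + 3 * x\<^sup>2" using \<open>\<tau> \<in> {0, 1}\<close> near \<psi> x powers by auto
  with \<psi>W show "- 3 * x\<^sup>2 \<le> \<psi> * (\<tau> + W)" "\<psi> * (\<tau> + W) \<le> x + 6 * x\<^sup>2"
    unfolding distrib_left by linarith+
  show "\<psi> * (\<tau> + W) \<le> 3 * x\<^sup>2" if "\<tau> = 0" using \<psi>W that by simp
qed

lemma unit_digit_step_ge:
  fixes x \<psi> s W e :: real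
  assumes "0 \<le> x - 2 * x ^ 3" "x - 2 * x ^ 3 \<le> \<psi>" "s \<in> {1, -1}" "e \<le> s * W" "-1 \<le> e"
  shows "(x - 2 * x ^ 3) * (1 + e) \<le> s * (\<psi> * (s + W))"
proof -
  have "(x - 2 * x ^ 3) * (1 + e) \<le> \<psi> * (1 + s * W)" using assms by (intro mult_mono) auto
  also have "\<dots> = s * (\<psi> * (s + W))" using assms(3) by auto
  finally show ?thesis .
qed

lemma unit_digit_after_zero_ge:
  fixes x \<psi> \<psi>' s W :: real
  assumes x: "0 < x" "x \<le> 1 / 1000" and \<psi>: "x - 2 * x ^ 3 \<le> \<psi>" "\<bar>\<psi>' - x\<bar> \<le> 3 * x\<^sup>2"
    and s: "s \<in> {1, -1}" and W: "\<bar>W\<bar> \<le> 20 * x"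
  shows "x - 30 * x ^ 3 \<le> s * (\<psi> * (s + \<psi>' * W))"
proof -
  note powers = small_powers[OF x]
  have "\<bar>\<psi>' * W\<bar> \<le> 21 * x\<^sup>2" using abs_mult_near_le[OF x \<psi>(2) W] powers(1) by simp
  then have "- (21 * x\<^sup>2) \<le> s * (\<psi>' * W)" using s by auto
  then have "(x - 2 * x ^ 3) * (1 + - (21 * x\<^sup>2)) \<le> s * (\<psi> * (s + \<psi>' * W))"
    using \<psi>(1) s powers x by (intro unit_digit_step_ge) linarith+
  moreover have "(x - 2 * x ^ 3) * (1 + - (21 * x\<^sup>2)) = x - 23 * x ^ 3 + 42 * x ^ 5" by algebra
  ultimately show ?thesis using powers by linarith
qed

lemma unit_digit_after_equal_ge:
  fixes x \<psi> \<psi>' s W :: real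
  assumes x: "0 < x" "x \<le> 1 / 1000" and \<psi>: "x - 2 * x ^ 3 \<le> \<psi>" "x - 2 * x ^ 3 \<le> \<psi>'"
    and s: "s \<in> {1, -1}" and W: "\<bar>W\<bar> \<le> 20 * x"
  shows "x + x\<^sup>2 - 30 * x ^ 3 \<le> s * (\<psi> * (s + \<psi>' * (s + W)))"
proof -
  note powers = small_powers[OF x]
  have pos: "0 \<le> x - 2 * x ^ 3" using powers x by linarith
  have "- (20 * x) \<le> s * W" using W s by auto
  then have "(x - 2 * x ^ 3) * (1 + - (20 * x)) \<le> s * (\<psi>' * (s + W))"
    using \<psi>(2) s pos x by (intro unit_digit_step_ge) linarith+
  moreover have "(x - 2 * x ^ 3) * (1 + - (20 * x)) = x - 20 * x ^ 2 - 2 * x ^ 3 + 40 * x ^ 4"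
    by algebra
  ultimately have "x - 21 * x\<^sup>2 \<le> s * (\<psi>' * (s + W))" using powers by linarith
  then have "(x - 2 * x ^ 3) * (1 + (x - 21 * x\<^sup>2)) \<le> s * (\<psi> * (s + \<psi>' * (s + W)))"
    using \<psi>(1) s pos powers x by (intro unit_digit_step_ge) linarith+
  moreover have "(x - 2 * x ^ 3) * (1 + (x - 21 * x\<^sup>2)) = x + x ^ 2 - 23 * x ^ 3 - 2 * x ^ 4 + 42 * x ^ 5"
    by algebra
  ultimately show ?thesis using powers by linarith
qed

section \<open>Partial quotients of two neighbouring values\<close>

locale two_quotient_cf = irrational_cf +
  fixes N :: nat and R\<^sub>o R\<^sub>e :: int and x :: real
  assumes R\<^sub>o: "odd R\<^sub>o" "1000 \<le> R\<^sub>o" and R\<^sub>e: "R\<^sub>e = R\<^sub>o - 1 \<or> R\<^sub>e = R\<^sub>o + 1"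
    and quotients: "\<And>k. N \<le> k \<Longrightarrow> a k = R\<^sub>o \<or> a k = R\<^sub>e"
    and x_def: "x = 1 / R\<^sub>o"
begin

lemma x_bounds: "0 < x" "x \<le> 1 / 1000"
proof -
  have "1000 \<le> real_of_int R\<^sub>o" using R\<^sub>o(2) by linarith
  then show "0 < x" "x \<le> 1 / 1000" unfolding x_def by (auto simp: divide_simps)
qed

lemmas x_powers = small_powers[OF x_bounds]

lemma even_R\<^sub>e: "even R\<^sub>e"
  using R\<^sub>o(1) R\<^sub>e by auto

lemma odd_quotient_iff: "N \<le> k \<Longrightarrow> odd (a k) \<longleftrightarrow> a k = R\<^sub>o"
  using quotients[of k] R\<^sub>o(1) even_R\<^sub>e by auto

lemma continued_fraction_near:
  fixes p r :: real
  assumes "p * (a k + r) = 1" "N \<le> k" "0 \<le> r" "r \<le> 1"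
  shows "\<bar>p - x\<bar> \<le> 3 * x\<^sup>2"
proof -
  define s where "s = a k + r - 1 / x"
  have "real_of_int R\<^sub>o - 1 \<le> a k" "a k \<le> real_of_int R\<^sub>o + 1"
    using quotients[OF assms(2)] R\<^sub>e by auto
  then have s: "\<bar>s\<bar> \<le> 2" using assms(3,4) unfolding s_def x_def by auto
  have "p * (1 / x + s) = 1" using assms(1) unfolding s_def by simp
  then have p: "p - x = - (x * s * p)" using x_bounds(1) by (simp add: field_simps)
  have "\<bar>x * s * p\<bar> \<le> x * 2 * \<bar>p\<bar>"
    unfolding abs_mult using s x_bounds(1) by (intro mult_right_mono mult_mono) auto
  then have dist: "\<bar>p - x\<bar> \<le> 2 * x * \<bar>p\<bar>" using p by simp
  also have "2 * x * \<bar>p\<bar> \<le> 2 / 1000 * \<bar>p\<bar>" using x_bounds(2) by (intro mult_right_mono) auto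
  finally have "\<bar>p\<bar> \<le> 3 / 2 * x" using x_bounds(1) by linarith
  then have "2 * x * \<bar>p\<bar> \<le> 2 * x * (3 / 2 * x)" using x_bounds(1) by (intro mult_left_mono) auto
  then show ?thesis using dist by (simp add: power2_eq_square)
qed

lemma continued_fraction_close:
  fixes p r :: real
  assumes "p * (R\<^sub>o + r) = 1" "0 \<le> r" "r \<le> 2 * x"
  shows "x - 2 * x ^ 3 \<le> p" "p \<le> x"
proof -
  have p: "p = x - x * r * p" using assms(1) R\<^sub>o(2) unfolding x_def by (simp add: field_simps)
  have "0 < p * (R\<^sub>o + r)" using assms(1) by simp
  then have "0 < p" using assms(2) R\<^sub>o(2) by (simp add: zero_less_mult_iff)
  then have "0 \<le> x * r * p" using x_bounds(1) assms(2) by simp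
  then show "p \<le> x" using p by linarith
  then have "x * r * p \<le> x * (2 * x) * x"
    using \<open>0 < p\<close> x_bounds(1) assms(2,3) by (intro mult_mono) auto
  then show "x - 2 * x ^ 3 \<le> p" using p by (simp add: power3_eq_cube)
qed

lemma \<phi>_near: "N < k \<Longrightarrow> \<bar>\<phi> k - x\<bar> \<le> 3 * x\<^sup>2"
  using continued_fraction_near[OF \<phi>_step[of "k - 1"]] \<phi>_nonneg \<phi>_le_1 by simp

lemma \<theta>_near: "N \<le> k \<Longrightarrow> \<bar>\<theta> k - x\<bar> \<le> 3 * x\<^sup>2"
  using continued_fraction_near[OF \<theta>_step[of k]] \<theta>_bounds[of "Suc k"] by simp

lemma \<phi>_le: "N < k \<Longrightarrow> \<phi> k \<le> 101 / 100 * x"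
  using \<phi>_near[of k] x_powers x_bounds by linarith

lemma \<theta>_le: "N \<le> k \<Longrightarrow> \<theta> k \<le> 101 / 100 * x"
  using \<theta>_near[of k] x_powers x_bounds by linarith

lemma \<phi>_close:
  assumes "Suc N < k" "a k = R\<^sub>o"
  shows "x - 2 * x ^ 3 \<le> \<phi> k" "\<phi> k \<le> x"
proof -
  obtain j where k: "k = Suc j" "N < j" using assms(1) by (cases k) auto
  have "\<phi> j \<le> 2 * x" using \<phi>_le[OF k(2)] x_bounds by linarith
  with \<phi>_step[of j] show "x - 2 * x ^ 3 \<le> \<phi> k" "\<phi> k \<le> x"
    using continued_fraction_close[of "\<phi> k" "\<phi> j"] \<phi>_nonneg[of j] assms(2) unfolding k by auto
qed

lemma \<theta>_close:
  assumes "N \<le> k" "a (Suc k) = R\<^sub>o"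
  shows "x - 2 * x ^ 3 \<le> \<theta> k" "\<theta> k \<le> x"
proof -
  have "\<theta> (Suc k) \<le> 2 * x" using \<theta>_le[of "Suc k"] assms(1) x_bounds by simp
  with \<theta>_step[of k] show "x - 2 * x ^ 3 \<le> \<theta> k" "\<theta> k \<le> x"
    using continued_fraction_close[of "\<theta> k" "\<theta> (Suc k)"] \<theta>_bounds[of "Suc k"] assms(2) by auto
qed

end

locale parity_digit_sequence =
  two_quotient_cf \<alpha> a N R\<^sub>o R\<^sub>e x + digit_sequence \<alpha> a 0 "\<lambda>k. a k mod 2" S T
  for \<alpha> a N R\<^sub>o R\<^sub>e x S T +
  assumes S_le_2: "\<bar>S k\<bar> \<le> 2" and T_le_2: "\<bar>T k\<bar> \<le> 2"
begin

lemma parity_digit: "real_of_int (a k mod 2) \<in> {0, 1}"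
proof -
  have "a k mod 2 = 0 \<or> a k mod 2 = 1" by presburger
  then show ?thesis by auto
qed

lemma abs_parity_digit_le: "\<bar>real_of_int (a k mod 2)\<bar> \<le> 1"
  using parity_digit[of k] by auto

lemma S_le:
  assumes "Suc N < k"
  shows "\<bar>S k\<bar> \<le> 2 * x"
proof -
  obtain j where k: "k = Suc (Suc j)" and j: "N \<le> j" using assms by (auto simp: less_iff_Suc_add)
  have "\<bar>S (Suc j)\<bar> \<le> 101 / 100 * x * (1 + 2)"
    unfolding S_Suc[of j, simplified]
    using abs_digit_step_le[OF \<phi>_nonneg \<phi>_le abs_parity_digit_le S_le_2] j by simp
  then have "\<bar>S (Suc j)\<bar> \<le> 4 * x" using x_bounds by simp
  then have "\<bar>S k\<bar> \<le> 101 / 100 * x * (1 + 4 * x)"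
    unfolding k S_Suc[of "Suc j", simplified]
    using abs_digit_step_le[OF \<phi>_nonneg \<phi>_le abs_parity_digit_le] j by simp
  also have "\<dots> \<le> 2 * x" using x_powers x_bounds by (simp add: algebra_simps power2_eq_square)
  finally show ?thesis .
qed

lemma T_le:
  assumes "N \<le> k"
  shows "\<bar>T k\<bar> \<le> 2 * x"
proof -
  have step: "\<bar>T k\<bar> \<le> 101 / 100 * x * (1 + w)" if "N \<le> k" "\<bar>T (Suc k)\<bar> \<le> w" for k w
    using abs_digit_step_le[OF less_imp_le[OF \<theta>_bounds(1)] \<theta>_le[OF that(1)] abs_parity_digit_le,
        of "- T (Suc k)"] that(2) T_eq[of k] by simp
  have "\<bar>T (Suc k)\<bar> \<le> 101 / 100 * x * (1 + 2)" using assms T_le_2 by (intro step) auto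
  then have "\<bar>T (Suc k)\<bar> \<le> 4 * x" using x_bounds by simp
  then have "\<bar>T k\<bar> \<le> 101 / 100 * x * (1 + 4 * x)" using assms by (intro step)
  also have "\<dots> \<le> 2 * x" using x_powers x_bounds by (simp add: algebra_simps power2_eq_square)
  finally show ?thesis .
qed

lemma S_bounds:
  assumes "N + 2 < k"
  shows "- 3 * x\<^sup>2 \<le> S k" "S k \<le> x + 6 * x\<^sup>2" and "a k \<noteq> R\<^sub>o \<Longrightarrow> S k \<le> 3 * x\<^sup>2"
proof -
  obtain j where k: "k = Suc j" "Suc N < j" using assms by (cases k) auto
  note step = zero_one_digit_step[OF x_bounds \<phi>_near parity_digit S_le[OF k(2)], of k k, folded k(1)]
  have S: "S k = \<phi> k * (real_of_int (a k mod 2) + S j)" using S_Suc[of j] k(1) by simp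
  show "- 3 * x\<^sup>2 \<le> S k" "S k \<le> x + 6 * x\<^sup>2" unfolding S using step(1,2) assms by simp_all
  show "S k \<le> 3 * x\<^sup>2" if "a k \<noteq> R\<^sub>o"
    unfolding S using step(3) that odd_quotient_iff[of k] assms
    by (simp add: even_iff_mod_2_eq_zero)
qed

lemma T_bounds:
  assumes "N \<le> k"
  shows "- 3 * x\<^sup>2 \<le> T k" "T k \<le> x + 6 * x\<^sup>2" and "a (Suc k) \<noteq> R\<^sub>o \<Longrightarrow> T k \<le> 3 * x\<^sup>2"
proof -
  have "\<bar>- T (Suc k)\<bar> \<le> 2 * x" using T_le[of "Suc k"] assms by simp
  note step = zero_one_digit_step[OF x_bounds \<theta>_near[OF assms] parity_digit this, of "Suc k"]
  have T: "T k = \<theta> k * (real_of_int (a (Suc k) mod 2) + - T (Suc k))" using T_eq[of k] by simp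
  show "- 3 * x\<^sup>2 \<le> T k" "T k \<le> x + 6 * x\<^sup>2" unfolding T using step(1,2) by simp_all
  show "T k \<le> 3 * x\<^sup>2" if "a (Suc k) \<noteq> R\<^sub>o"
    unfolding T using step(3) that odd_quotient_iff[of "Suc k"] assms
    by (simp add: even_iff_mod_2_eq_zero)
qed

lemma S_le_odd:
  assumes "N + 3 < k" "a k = R\<^sub>o"
  shows "S k \<le> x + x\<^sup>2 + 6 * x ^ 3"
proof -
  obtain j where k: "k = Suc j" "N + 2 < j" using assms(1) by (cases k) auto
  have "S k = \<phi> k * (1 + S j)"
    using S_Suc[of j] assms(2) R\<^sub>o(1) k(1) by (simp add: odd_iff_mod_2_eq_one)
  also have "\<dots> \<le> x * (1 + (x + 6 * x\<^sup>2))"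
    using \<phi>_close(2)[of k] assms S_bounds(1,2)[OF k(2)] x_powers x_bounds by (intro mult_mono) auto
  also have "\<dots> = x + x\<^sup>2 + 6 * x ^ 3" by algebra
  finally show ?thesis .
qed

lemma T_le_odd:
  assumes "N \<le> k" "a (Suc k) = R\<^sub>o"
  shows "T k \<le> x + 3 * x ^ 3"
proof -
  have "T k = \<theta> k * (1 - T (Suc k))"
    using T_eq[of k] assms(2) R\<^sub>o(1) by (simp add: odd_iff_mod_2_eq_one)
  also have "\<dots> \<le> x * (1 + 3 * x\<^sup>2)"
    using \<theta>_close(2)[OF assms] T_bounds(1,2)[of "Suc k"] assms(1) x_powers x_bounds
    by (intro mult_mono) auto
  also have "\<dots> = x + 3 * x ^ 3" by algebra
  finally show ?thesis .
qed

lemma parity_small_digit_sequence: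
  assumes "\<And>k. N \<le> k \<Longrightarrow> a k = R\<^sub>o \<or> a (Suc k) = R\<^sub>o"
  shows "small_digit_sequence \<alpha> a (N + 4) (\<lambda>k. a k mod 2) S T (lower_poly x)"
proof unfold_locales
  fix k assume k: "N + 4 \<le> k"
  then have k': "N < k" "N \<le> k" "Suc N < k" "N + 2 < k" "N + 3 < k" by auto
  have "S k \<le> 3 * x\<^sup>2 \<or> T k \<le> 3 * x\<^sup>2 \<or> a k = R\<^sub>o \<and> a (Suc k) = R\<^sub>o"
    using S_bounds(3)[OF k'(4)] T_bounds(3)[OF k'(2)] by blast
  then show "vertices_ge (lower_poly x) (\<phi> k) (\<theta> k) (S k) (T k)"
    using S_bounds(1,2)[OF k'(4)] T_bounds(1,2)[OF k'(2)] S_le_odd[OF k'(5)] T_le_odd[OF k'(2)]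
      \<phi>_close[OF k'(3)] \<theta>_close[OF k'(2)]
    by (intro vertices_ge_if_loose_or_tight[OF x_bounds \<phi>_near[OF k'(1)] \<theta>_near[OF k'(2)]]) blast+
  show "\<bar>S k\<bar> \<le> 1 / 10" "\<bar>T k\<bar> \<le> 1 / 10" "\<phi> k \<le> 1 / 10" "\<theta> k \<le> 1 / 10"
    using S_le[OF k'(3)] T_le[OF k'(2)] \<phi>_le[OF k'(1)] \<theta>_le[OF k'(2)] x_bounds by linarith+
  show "S (Suc k) = \<phi> (Suc k) * (real_of_int (a (Suc k) mod 2) + S k)" by (rule S_Suc) simp
  show "T k = \<theta> k * (real_of_int (a (Suc k) mod 2) - T (Suc k))" by (rule T_eq) simp
  show "even (a (Suc k) + a (Suc k) mod 2)" by (rule parity) simp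
next
  show "lower_poly x \<le> 1" using x_powers x_bounds by linarith
qed

end

context two_quotient_cf begin

lemma rho_ge_if_no_consecutive_even:
  assumes "\<And>k. N \<le> k \<Longrightarrow> a k = R\<^sub>o \<or> a (Suc k) = R\<^sub>o"
  shows "ereal (lower_poly x / 4) \<le> rho \<alpha>"
proof -
  have "\<bar>a k mod 2\<bar> \<le> 1" "even (a (Suc k) + a (Suc k) mod 2)" for k by presburger+
  then obtain \<gamma> S T where "digit_sequence \<alpha> a 0 (\<lambda>k. a k mod 2) S T"
    and cell: "cell \<gamma> 0 (S 0) (T 0)"
    and "\<forall>k. \<bar>S k\<bar> \<le> 2" "\<forall>k. \<bar>T k\<bar> \<le> 2"
    by (rule digit_sequence_exists[of "\<lambda>k. a k mod 2"])
  then interpret parity_digit_sequence \<alpha> a N R\<^sub>o R\<^sub>e x S T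
    by (simp add: parity_digit_sequence_def parity_digit_sequence_axioms_def two_quotient_cf_axioms)
  show ?thesis
    using small_digit_sequence.rho_ge[OF parity_small_digit_sequence[OF assms] cell_at[OF cell]]
    by simp
qed

end

locale tight_digit_sequence =
  two_quotient_cf \<alpha> a N R\<^sub>o R\<^sub>e x + digit_sequence \<alpha> a M \<tau> S T
  for \<alpha> a N R\<^sub>o R\<^sub>e x M \<tau> S T +
  assumes N_less_M: "N < M"
    and S_le: "M \<le> k \<Longrightarrow> \<bar>S k\<bar> \<le> 20 * x" and T_le: "M \<le> k \<Longrightarrow> \<bar>T k\<bar> \<le> 20 * x"
    and vertices: "M \<le> k \<Longrightarrow> vertices_ge (upper_poly x) (\<phi> k) (\<theta> k) (S k) (T k)"
begin

lemma S_eq: "M < k \<Longrightarrow> S k = \<phi> k * (\<tau> k + S (k - 1))"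
  using S_Suc[of "k - 1"] by simp

lemma parity_iff: "M < k \<Longrightarrow> even (\<tau> k) \<longleftrightarrow> even (a k)"
  using parity[of "k - 1"] by simp

lemma digit_sum_le:
  assumes "M < k"
  shows "\<bar>\<tau> k\<bar> + \<bar>\<tau> (Suc k)\<bar> \<le> 2"
proof -
  have k: "M \<le> k" "M \<le> k - 1" "N < k" "N \<le> k" using assms N_less_M by auto
  have sum: "\<bar>S k\<bar> + \<bar>T k\<bar> \<le> 2 * x + 452 * x\<^sup>2"
    using x_powers x_bounds
    by (intro vertices_ge_imp_sum_le[OF x_bounds \<phi>_near[OF k(3)] \<theta>_near[OF k(4)]
          S_le[OF k(1)] T_le[OF k(1)] _ vertices[OF k(1)]]) simp
  have "(x - 3 * x\<^sup>2) * \<bar>\<tau> k\<bar> \<le> \<bar>S k\<bar> + 21 * x\<^sup>2"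
    unfolding S_eq[OF assms]
    using abs_digit_le[OF x_bounds \<phi>_near[OF k(3)] S_le[OF k(2)], of "\<tau> k"] by simp
  moreover have "(x - 3 * x\<^sup>2) * \<bar>\<tau> (Suc k)\<bar> \<le> \<bar>T k\<bar> + 21 * x\<^sup>2"
    using abs_digit_le[OF x_bounds \<theta>_near[OF k(4)], of "- T (Suc k)" "\<tau> (Suc k)"]
      T_le[of "Suc k"] T_eq[OF k(1)] k(1) by simp
  ultimately have "(x - 3 * x\<^sup>2) * (\<bar>\<tau> k\<bar> + \<bar>\<tau> (Suc k)\<bar>) \<le> 2 * x + 494 * x\<^sup>2"
    using sum unfolding of_int_add distrib_left by linarith
  also have "\<dots> < (x - 3 * x\<^sup>2) * 3" using x_powers x_bounds by simp
  finally have "real_of_int (\<bar>\<tau> k\<bar> + \<bar>\<tau> (Suc k)\<bar>) < 3"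
    using x_powers x_bounds by (simp only: mult_less_cancel_left_pos)
  then show ?thesis by linarith
qed

lemma unit_digits:
  assumes "M < k" "odd (a k)" "odd (a (Suc k))"
  shows "\<tau> k \<in> {1, -1}" "\<tau> (Suc k) \<in> {1, -1}"
proof -
  have "odd (\<tau> k)" "odd (\<tau> (Suc k))" using parity_iff[of k] parity_iff[of "Suc k"] assms by auto
  with digit_sum_le[OF assms(1)] have "\<bar>\<tau> k\<bar> = 1" "\<bar>\<tau> (Suc k)\<bar> = 1" by presburger+
  then show "\<tau> k \<in> {1, -1}" "\<tau> (Suc k) \<in> {1, -1}" by auto
qed

lemma zero_digit_before_odd:
  assumes "M < k" "even (a k)" "odd (a (Suc k))"
  shows "\<tau> k = 0"
proof -
  have "even (\<tau> k)" "odd (\<tau> (Suc k))" using parity_iff[of k] parity_iff[of "Suc k"] assms by auto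
  with digit_sum_le[OF assms(1)] show ?thesis by presburger
qed

lemma zero_digit_after_odd:
  assumes "M < k" "odd (a k)" "even (a (Suc k))"
  shows "\<tau> (Suc k) = 0"
proof -
  have "odd (\<tau> k)" "even (\<tau> (Suc k))" using parity_iff[of k] parity_iff[of "Suc k"] assms by auto
  with digit_sum_le[OF assms(1)] show ?thesis by presburger
qed

lemma no_opposite_digits_after_zero:
  assumes k: "M < k" and odd: "a (k + 1) = R\<^sub>o" "a (k + 2) = R\<^sub>o" "a (k + 3) = R\<^sub>o"
    and digits: "\<tau> k = 0" "\<tau> (k + 1) \<in> {1, -1}" "\<tau> (k + 2) \<in> {1, -1}"
  shows "\<tau> (k + 3) \<noteq> - \<tau> (k + 2)"
proof
  define s t where "s = real_of_int (\<tau> (k + 1))" and "t = real_of_int (\<tau> (k + 2))"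
  assume opposite: "\<tau> (k + 3) = - \<tau> (k + 2)"
  have st: "s \<in> {1, -1}" "t \<in> {1, -1}" using digits(2,3) unfolding s_def t_def by auto
  have le: "M \<le> k + 1" "M \<le> k + 2" "M \<le> k - 1" "N < k" "Suc N < k + 1" "N \<le> k + 1" "N \<le> k + 2"
    using k N_less_M by auto
  have odd': "a (Suc (k + 1)) = R\<^sub>o" "a (Suc (k + 2)) = R\<^sub>o"
    using odd by (simp_all add: eval_nat_numeral)
  note close = \<phi>_close[OF le(5) odd(1)] \<theta>_close[OF le(6) odd'(1)] \<theta>_close[OF le(7) odd'(2)]
  have "S (k + 1) = \<phi> (k + 1) * (s + \<phi> k * S (k - 1))"
    using S_eq[of k] S_eq[of "k + 1"] k digits(1) unfolding s_def by simp
  then have S: "x + 0 * x\<^sup>2 - 30 * x ^ 3 \<le> s * S (k + 1)"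
    using unit_digit_after_zero_ge[OF x_bounds close(1) \<phi>_near[OF le(4)] st(1) S_le[OF le(3)]]
    by simp
  have "T (k + 2) = \<theta> (k + 2) * (- t - T (k + 3))"
    using T_eq[OF le(2)] opposite unfolding t_def by (simp add: eval_nat_numeral)
  moreover have "T (k + 1) = \<theta> (k + 1) * (t - T (k + 2))"
    using T_eq[OF le(1)] unfolding t_def by (simp add: eval_nat_numeral)
  ultimately have "T (k + 1) = \<theta> (k + 1) * (t + \<theta> (k + 2) * (t + T (k + 3)))" by algebra
  moreover have "\<bar>T (k + 3)\<bar> \<le> 20 * x" using k by (intro T_le) simp
  ultimately have T: "x + (1 - 0) * x\<^sup>2 - 30 * x ^ 3 \<le> t * T (k + 1)"
    using unit_digit_after_equal_ge[OF x_bounds close(3,5) st(2)] by simp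
  show False
    using not_vertices_ge_if_center_ge[OF x_bounds close(1-4) S_le[OF le(1)] T_le[OF le(1)] st _ _ S T]
      vertices[OF le(1)] by simp
qed

lemma no_equal_digits_before_zero:
  assumes k: "M < k" and odd: "a k = R\<^sub>o" "a (k + 1) = R\<^sub>o" "a (k + 2) = R\<^sub>o"
    and digits: "\<tau> k \<in> {1, -1}" "\<tau> (k + 2) \<in> {1, -1}" "\<tau> (k + 3) = 0"
  shows "\<tau> (k + 1) \<noteq> \<tau> k"
proof
  define s t where "s = real_of_int (\<tau> k)" and "t = real_of_int (\<tau> (k + 2))"
  assume equal: "\<tau> (k + 1) = \<tau> k"
  have st: "s \<in> {1, -1}" "t \<in> {1, -1}" using digits(1,2) unfolding s_def t_def by auto
  have le: "M \<le> k + 1" "M \<le> k + 2" "M \<le> k - 1" "Suc N < k" "Suc N < k + 1" "N \<le> k + 1" "N \<le> k + 2"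
    using k N_less_M by auto
  have odd': "a (Suc (k + 1)) = R\<^sub>o" using odd by (simp add: eval_nat_numeral)
  note close = \<phi>_close[OF le(5) odd(2)] \<theta>_close[OF le(6) odd'] \<phi>_close[OF le(4) odd(1)]
  have "S (k + 1) = \<phi> (k + 1) * (s + \<phi> k * (s + S (k - 1)))"
    using S_eq[of k] S_eq[of "k + 1"] k equal unfolding s_def by simp
  then have S: "x + 1 * x\<^sup>2 - 30 * x ^ 3 \<le> s * S (k + 1)"
    using unit_digit_after_equal_ge[OF x_bounds close(1,5) st(1) S_le[OF le(3)]] by simp
  have "T (k + 1) = \<theta> (k + 1) * (t + \<theta> (k + 2) * T (k + 3))"
    using T_eq[OF le(1)] T_eq[OF le(2)] digits(3) unfolding t_def by (simp add: eval_nat_numeral)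
  moreover have "\<bar>T (k + 3)\<bar> \<le> 20 * x" using k by (intro T_le) simp
  ultimately have T: "x + (1 - 1) * x\<^sup>2 - 30 * x ^ 3 \<le> t * T (k + 1)"
    using unit_digit_after_zero_ge[OF x_bounds close(3) \<theta>_near[OF le(7)] st(2)] by simp
  show False
    using not_vertices_ge_if_center_ge[OF x_bounds close(1-4) S_le[OF le(1)] T_le[OF le(1)] st _ _ S T]
      vertices[OF le(1)] by simp
qed

end

context two_quotient_cf begin

definition isolated_block :: "nat \<Rightarrow> bool" where
  "isolated_block L \<longleftrightarrow> (\<forall>i\<le>5. a (L + i) = (if i \<in> {0, 5} then R\<^sub>e else R\<^sub>o))"

lemma no_isolated_block:
  assumes "tight_digit_sequence \<alpha> a N R\<^sub>o R\<^sub>e x M \<tau> S T" "M < L"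
  shows "\<not> isolated_block L"
proof
  interpret tight_digit_sequence \<alpha> a N R\<^sub>o R\<^sub>e x M \<tau> S T by fact
  assume "isolated_block L"
  then have block: "a (L + i) = (if i \<in> {0, 5} then R\<^sub>e else R\<^sub>o)" if "i \<le> 5" for i
    using that unfolding isolated_block_def by blast
  have odd: "a (L + 1) = R\<^sub>o" "a (L + 2) = R\<^sub>o" "a (L + 3) = R\<^sub>o" "a (L + 4) = R\<^sub>o"
    and even: "a L = R\<^sub>e" "a (L + 5) = R\<^sub>e"
    using block[of 0] block[of 1] block[of 2] block[of 3] block[of 4] block[of 5] by simp_all
  have "\<tau> L = 0" using zero_digit_before_odd[of L] assms(2) odd even even_R\<^sub>e R\<^sub>o(1) by simp
  moreover have "\<tau> (L + 5) = 0"
    using zero_digit_after_odd[of "L + 4"] assms(2) odd even even_R\<^sub>e R\<^sub>o(1)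
    by (simp add: eval_nat_numeral)
  moreover have "\<tau> (L + 1) \<in> {1, -1}" "\<tau> (L + 2) \<in> {1, -1}" "\<tau> (L + 3) \<in> {1, -1}" "\<tau> (L + 4) \<in> {1, -1}"
    using unit_digits[of "L + 1"] unit_digits[of "L + 3"] assms(2) odd R\<^sub>o(1)
    by (simp_all add: eval_nat_numeral)
  moreover from this have "\<tau> (L + 3) = - \<tau> (L + 2) \<or> \<tau> (L + 3) = \<tau> (L + 2)" by auto
  ultimately show False
    using no_opposite_digits_after_zero[of L] no_equal_digits_before_zero[of "L + 2", unfolded add.assoc]
      assms(2) odd by auto
qed

lemma cell_with_small_center:
  assumes "grid_large \<gamma> (upper_poly x) k" and k: "N < k"
  obtains S T where "cell \<gamma> k S T" "\<bar>S\<bar> \<le> 20 * x" "\<bar>T\<bar> \<le> 20 * x"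
    "vertices_ge (upper_poly x) (\<phi> k) (\<theta> k) S T"
proof -
  obtain \<xi> \<eta> where \<xi>\<eta>: "\<bar>\<xi>\<bar> \<le> 1" "\<bar>\<eta>\<bar> \<le> 1" and cell: "cell \<gamma> k (\<xi> + \<eta> * \<phi> k) (\<eta> - \<xi> * \<theta> k)"
    by (rule cell_exists)
  have \<phi>: "0 \<le> \<phi> k" "\<phi> k \<le> 101 / 100 * x" and \<theta>: "0 \<le> \<theta> k" "\<theta> k \<le> 101 / 100 * x"
    using \<phi>_nonneg[of k] \<phi>_le[OF k] \<theta>_bounds(1)[of k] \<theta>_le[of k] k by auto
  have product_le: "\<bar>u * \<psi>\<bar> \<le> \<bar>u\<bar> / 100" if "0 \<le> \<psi>" "\<psi> \<le> 101 / 100 * x" for u \<psi> :: real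
  proof -
    have "\<bar>u\<bar> * \<psi> \<le> \<bar>u\<bar> * (1 / 100)" using that x_bounds by (intro mult_left_mono) auto
    then show ?thesis using that(1) by (simp add: abs_mult)
  qed
  note products = product_le[OF \<phi>, of \<eta>] product_le[OF \<theta>, of \<xi>]
  have "\<bar>\<eta> - \<xi> * \<theta> k\<bar> \<le> 2" using products \<xi>\<eta> by linarith
  with assms(1) cell have vertices:
      "vertices_ge (upper_poly x) (\<phi> k) (\<theta> k) (\<xi> + \<eta> * \<phi> k) (\<eta> - \<xi> * \<theta> k)"
    by (rule vertices_ge_if_grid_large)
  have "101 / 100 * x \<le> 1" using x_bounds by simp
  note center = vertices_ge_imp_small_center[OF \<phi> \<theta> this \<xi>\<eta> vertices]
  have "1 - upper_poly x + 12 * (101 / 100 * x) \<le> 15 * x" using x_powers x_bounds by linarith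
  with center products have "\<bar>\<xi> + \<eta> * \<phi> k\<bar> \<le> 20 * x" "\<bar>\<eta> - \<xi> * \<theta> k\<bar> \<le> 20 * x"
    using x_bounds by linarith+
  with cell vertices show ?thesis using that by blast
qed

lemma tight_digit_sequence_exists:
  assumes large: "\<And>k. M \<le> k \<Longrightarrow> grid_large \<gamma> (upper_poly x) k" and M: "N < M"
  shows "\<exists>\<tau> S T. tight_digit_sequence \<alpha> a N R\<^sub>o R\<^sub>e x M \<tau> S T"
proof -
  have "\<forall>k. \<exists>S T. M \<le> k \<longrightarrow> cell \<gamma> k S T \<and> \<bar>S\<bar> \<le> 20 * x \<and> \<bar>T\<bar> \<le> 20 * x \<and>
      vertices_ge (upper_poly x) (\<phi> k) (\<theta> k) S T"
    using cell_with_small_center[OF large] M by (metis order_less_le_trans)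
  then obtain S T where ST: "\<And>k. M \<le> k \<Longrightarrow> cell \<gamma> k (S k) (T k)" "\<And>k. M \<le> k \<Longrightarrow> \<bar>S k\<bar> \<le> 20 * x"
    "\<And>k. M \<le> k \<Longrightarrow> \<bar>T k\<bar> \<le> 20 * x" "\<And>k. M \<le> k \<Longrightarrow> vertices_ge (upper_poly x) (\<phi> k) (\<theta> k) (S k) (T k)"
    by metis
  have "\<exists>\<tau>::int. S (Suc k) = \<phi> (Suc k) * (\<tau> + S k) \<and> T k = \<theta> k * (\<tau> - T (Suc k)) \<and>
      even (a (Suc k) + \<tau>)"
    if k: "M \<le> k" for k
  proof -
    have Suc_k: "M \<le> Suc k" using k by simp
    have "20 * x \<le> 21 * \<phi> (Suc k)" using \<phi>_near[of "Suc k"] k M x_powers x_bounds by simp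
    then have "\<bar>S (Suc k)\<bar> / \<phi> (Suc k) \<le> 21"
      using ST(2)[OF Suc_k] \<phi>_Suc_pos[of k] by (simp add: divide_le_eq)
    then have "\<theta> k * (\<bar>S (Suc k)\<bar> / \<phi> (Suc k) + \<bar>S k\<bar> + \<bar>T (Suc k)\<bar>) \<le> (101 / 100 * x) * 22"
      using \<theta>_le[of k] k M ST(2)[OF k] ST(3)[OF Suc_k] x_bounds \<phi>_Suc_pos[of k]
      by (intro mult_mono) auto
    then have "\<theta> k * (\<bar>S (Suc k)\<bar> / \<phi> (Suc k) + \<bar>S k\<bar> + \<bar>T (Suc k)\<bar>) + \<bar>T k\<bar> < 2"
      using ST(3)[OF k] x_bounds by linarith
    from cell_digit[OF ST(1)[OF k] ST(1)[OF Suc_k] this] show ?thesis by blast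
  qed
  then obtain \<sigma> :: "nat \<Rightarrow> int" where \<sigma>: "\<And>k. M \<le> k \<Longrightarrow> S (Suc k) = \<phi> (Suc k) * (\<sigma> k + S k) \<and>
      T k = \<theta> k * (\<sigma> k - T (Suc k)) \<and> even (a (Suc k) + \<sigma> k)" by metis
  have "tight_digit_sequence \<alpha> a N R\<^sub>o R\<^sub>e x M (\<lambda>k. \<sigma> (k - 1)) S T"
  proof unfold_locales
    fix k assume k: "M \<le> k"
    show "S (Suc k) = \<phi> (Suc k) * (\<sigma> (Suc k - 1) + S k)" "T k = \<theta> k * (\<sigma> (Suc k - 1) - T (Suc k))"
      "even (a (Suc k) + \<sigma> (Suc k - 1))"
      using \<sigma>[OF k] unfolding diff_Suc_1 by blast+
    show "\<bar>S k\<bar> \<le> 20 * x" "\<bar>T k\<bar> \<le> 20 * x" "vertices_ge (upper_poly x) (\<phi> k) (\<theta> k) (S k) (T k)"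
      using ST[OF k] by blast+
  qed (rule M)
  then show ?thesis by blast
qed

lemma rho_le_if_isolated_blocks:
  assumes "\<And>K. \<exists>L\<ge>K. isolated_block L"
  shows "rho \<alpha> \<le> ereal (upper_poly x / 4)"
proof (rule rho_leI, rule ccontr)
  fix \<gamma> assume "\<gamma> \<notin> int_span \<alpha>" "\<not> approx_const \<alpha> \<gamma> \<le> ereal (upper_poly x / 4)"
  then obtain K where "\<And>k. K \<le> k \<Longrightarrow> grid_large \<gamma> (upper_poly x) k"
    using eventually_grid_large[of \<gamma> "upper_poly x"] unfolding eventually_sequentially
    by (auto simp: not_le)
  then have "\<exists>\<tau> S T. tight_digit_sequence \<alpha> a N R\<^sub>o R\<^sub>e x (max K (Suc N)) \<tau> S T"
    by (intro tight_digit_sequence_exists) auto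
  then obtain \<tau> S T where seq: "tight_digit_sequence \<alpha> a N R\<^sub>o R\<^sub>e x (max K (Suc N)) \<tau> S T" by blast
  obtain L where "Suc (max K (Suc N)) \<le> L" "isolated_block L" using assms by blast
  with no_isolated_block[OF seq, of L] show False by (simp add: Suc_le_eq)
qed

end

section \<open>The period \<open>R\<^sub>*\<^sub>*, R\<^sub>*, R\<^sub>*, R\<^sub>*, R\<^sub>*\<close>\<close>

lemma ereal_abs_diff_leI:
  assumes "ereal (b - c) \<le> r" "r \<le> ereal (b + c)"
  shows "\<bar>r - ereal b\<bar> \<le> ereal c"
  using assms by (cases r) auto

context irrational_cf begin

lemma rho_estimate_coarse:
  assumes x: "1 / 1000 \<le> x" "x \<le> 1 / 2"
  shows "\<bar>rho \<alpha> - ereal (1 / 4 * (1 - 2 * x - 2 * x\<^sup>2))\<bar> \<le> ereal (3 * 10 ^ 9 * x ^ 3)"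
proof -
  define b E where "b = 1 / 4 * (1 - 2 * x - 2 * x\<^sup>2)" and "E = 3 * 10 ^ 9 * x ^ 3"
  have "(1 / 1000) ^ 3 \<le> x ^ 3" using x by (intro power_mono) auto
  then have "3 \<le> E" unfolding E_def by (simp add: power_divide)
  have "x\<^sup>2 \<le> (1 / 2)\<^sup>2" using x by (intro power_mono) auto
  then have "x\<^sup>2 \<le> 1 / 4" by (simp add: power_divide)
  moreover have "0 \<le> x\<^sup>2" by simp
  ultimately have "- 4 \<le> 1 - 2 * x - 2 * x\<^sup>2" "1 - 2 * x - 2 * x\<^sup>2 \<le> 4" using x by linarith+
  then have "-1 \<le> b" "b \<le> 1" unfolding b_def by simp_all
  with \<open>3 \<le> E\<close> have "ereal (b - E) \<le> ereal 0" "ereal 2 \<le> ereal (b + E)" by simp_all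
  with rho_nonneg[of \<alpha>] rho_le_2 show ?thesis
    unfolding b_def[symmetric] E_def[symmetric] zero_ereal_def
    by (blast intro: ereal_abs_diff_leI order_trans)
qed

lemma rho_estimate_fine:
  assumes "two_quotient_cf \<alpha> a N R\<^sub>o R\<^sub>e x"
    and periodic: "\<And>k. a (N + k) = (if k mod 5 = 0 then R\<^sub>e else R\<^sub>o)"
  shows "\<bar>rho \<alpha> - ereal (1 / 4 * (1 - 2 * x - 2 * x\<^sup>2))\<bar> \<le> ereal (3 * 10 ^ 9 * x ^ 3)"
proof (rule ereal_abs_diff_leI)
  interpret two_quotient_cf \<alpha> a N R\<^sub>o R\<^sub>e x by fact
  have "a k = R\<^sub>o \<or> a (Suc k) = R\<^sub>o" if "N \<le> k" for k
  proof -
    have "(k - N) mod 5 \<noteq> 0 \<or> Suc (k - N) mod 5 \<noteq> 0" by presburger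
    then show ?thesis using periodic[of "k - N"] periodic[of "Suc (k - N)"] that by auto
  qed
  then have "ereal (lower_poly x / 4) \<le> rho \<alpha>" by (rule rho_ge_if_no_consecutive_even)
  moreover have "ereal (1 / 4 * (1 - 2 * x - 2 * x\<^sup>2) - 3 * 10 ^ 9 * x ^ 3) \<le> ereal (lower_poly x / 4)"
    using x_powers(3) by (simp add: field_simps)
  ultimately show "ereal (1 / 4 * (1 - 2 * x - 2 * x\<^sup>2) - 3 * 10 ^ 9 * x ^ 3) \<le> rho \<alpha>"
    by (rule order_trans[rotated])
  have "isolated_block (N + 5 * K)" for K
    unfolding isolated_block_def
  proof (intro allI impI)
    fix i :: nat assume "i \<le> 5"
    then have "(5 * K + i) mod 5 = 0 \<longleftrightarrow> i = 0 \<or> i = 5" by presburger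
    then show "a (N + 5 * K + i) = (if i \<in> {0, 5} then R\<^sub>e else R\<^sub>o)"
      using periodic[of "5 * K + i"] by (simp add: add.assoc)
  qed
  then have "\<exists>L\<ge>K. isolated_block L" for K by (intro exI[of _ "N + 5 * K"]) simp
  then have "rho \<alpha> \<le> ereal (upper_poly x / 4)" by (rule rho_le_if_isolated_blocks)
  moreover have "ereal (upper_poly x / 4) \<le> ereal (1 / 4 * (1 - 2 * x - 2 * x\<^sup>2) + 3 * 10 ^ 9 * x ^ 3)"
    using x_powers(3) by (simp add: field_simps)
  ultimately show "rho \<alpha> \<le> ereal (1 / 4 * (1 - 2 * x - 2 * x\<^sup>2) + 3 * 10 ^ 9 * x ^ 3)"
    by (rule order_trans)
qed

lemma rho_estimate:
  assumes R: "odd R\<^sub>o" "2 \<le> R\<^sub>o" "R\<^sub>e = R\<^sub>o - 1 \<or> R\<^sub>e = R\<^sub>o + 1"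
    and periodic: "eventually_periodic [R\<^sub>e, R\<^sub>o, R\<^sub>o, R\<^sub>o, R\<^sub>o] a"
    and x: "x = 1 / real_of_int R\<^sub>o"
  shows "\<bar>rho \<alpha> - ereal (1 / 4 * (1 - 2 * x - 2 * x\<^sup>2))\<bar> \<le> ereal (3 * 10 ^ 9 * x ^ 3)"
proof (cases "R\<^sub>o < 1000")
  case True
  then show ?thesis using R(2) by (intro rho_estimate_coarse) (simp_all add: x divide_simps)
next
  case False
  obtain N where "\<And>k. a (N + k) = [R\<^sub>e, R\<^sub>o, R\<^sub>o, R\<^sub>o, R\<^sub>o] ! (k mod 5)"
    using periodic unfolding eventually_periodic_def by auto
  moreover have "[R\<^sub>e, R\<^sub>o, R\<^sub>o, R\<^sub>o, R\<^sub>o] ! j = (if j = 0 then R\<^sub>e else R\<^sub>o)" if "j < 5" for j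
    using that by (auto simp: less_Suc_eq numeral_eq_Suc)
  ultimately have a_eq: "a (N + k) = (if k mod 5 = 0 then R\<^sub>e else R\<^sub>o)" for k by simp
  have "two_quotient_cf \<alpha> a N R\<^sub>o R\<^sub>e x"
  proof unfold_locales
    show "a k = R\<^sub>o \<or> a k = R\<^sub>e" if "N \<le> k" for k using a_eq[of "k - N"] that by auto
  qed (use R False x in auto)
  then show ?thesis using a_eq by (rule rho_estimate_fine)
qed

end

theorem theorem6:
  shows "\<exists>C::real. C > 0 \<and>
    (\<forall>(R::int) (Rodd::int) (Reven::int) (\<alpha>::real) (a::nat \<Rightarrow> int).
       R \<ge> 2 \<longrightarrow>
       Rodd \<in> {R, R + 1} \<longrightarrow> odd Rodd \<longrightarrow>
       Reven \<in> {R, R + 1} \<longrightarrow> even Reven \<longrightarrow>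
       \<alpha> \<notin> \<rat> \<longrightarrow>
       regular_cf \<alpha> a \<longrightarrow>
       eventually_periodic [Reven, Rodd, Rodd, Rodd, Rodd] a \<longrightarrow>
       \<bar>rho \<alpha> - ereal (1 / 4 * (1 - 2 / real_of_int Rodd - 2 / (real_of_int Rodd)\<^sup>2))\<bar>
         \<le> ereal (C / (real_of_int Rodd) ^ 3))"
proof (intro exI[of _ "3 * 10 ^ 9"] conjI allI impI)
  fix R Rodd Reven :: int and \<alpha> :: real and a :: "nat \<Rightarrow> int"
  assume "R \<ge> 2" "Rodd \<in> {R, R + 1}" "odd Rodd" "Reven \<in> {R, R + 1}" "even Reven"
    and \<alpha>: "\<alpha> \<notin> \<rat>" "regular_cf \<alpha> a"
    and periodic: "eventually_periodic [Reven, Rodd, Rodd, Rodd, Rodd] a"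
  then have R: "odd Rodd" "2 \<le> Rodd" "Reven = Rodd - 1 \<or> Reven = Rodd + 1" by auto
  interpret irrational_cf \<alpha> a using \<alpha> by unfold_locales
  show "\<bar>rho \<alpha> - ereal (1 / 4 * (1 - 2 / real_of_int Rodd - 2 / (real_of_int Rodd)\<^sup>2))\<bar>
      \<le> ereal (3 * 10 ^ 9 / (real_of_int Rodd) ^ 3)"
    using rho_estimate[OF R periodic refl] by (simp add: power_divide)
qed simp

end
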